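(* Let $q\ge 3$ be an odd integer, let $l_1\neq 0$ and $\alpha\neq 0$ be real numbers, and let $\Phi:\mathbb{R}\to\mathbb{R}$ be a smooth function with $\Phi(s)=l_1 s+O(s^2)$ as $s\to 0$. Consider the one-parameter family of planar flows, written in the complex coordinate $z=x+iy$, $$\dot z = i\mu z + i\Phi(|z|^2)z + i\alpha (z^* )^{2q-1} + R(z,z^*,\mu),$$ where $\mu\in\mathbb{R}$ is a parameter, $R$ is smooth in $(x,y,\mu)$ with $R=O(|z|^{2q+1})$ uniformly for small $\mu$, and for every $\mu$ the vector field is divergence-free (area-preserving). Then there is a neighbourhood $U$ of $z=0$ such that for all sufficiently small $\mu\neq 0$: (i) if $\mu l_1>0$, the only equilibrium in $U$ is $z=0$, and it is a center; (ii) if $\mu l_1<0$, the flow has in $U$, besides the center $z=0$, exactly $4q$ nonzero equilibria $z_0,\dots,z_{4q-1}$ with $|z_k|^2=-\mu/l_1+O(\mu^2)$ and $\arg z_k = k\pi/(2q)+o(1)$ as $\mu\to0$; they are nondegenerate and alternate in type: if $\alpha l_1>0$, the $z_k$ with $k$ even are saddles and those with $k$ odd are centers, while if $\alpha l_1<0$, the $z_k$ with $k$ even are centers and those with $k$ odd are saddles. Thus they form a ring ("garland") of $2q$ saddles and $2q$ centers.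
   Context: $z^*$ denotes the complex conjugate of $z$. A center is a nondegenerate equilibrium with purely imaginary nonzero eigenvalues (for an area-preserving planar flow it is surrounded by closed orbits); a saddle is an equilibrium with real eigenvalues of opposite signs. This flow is the flow normal form for a centrally symmetric ($f(-z)=-f(z)$) area-preserving planar map with an elliptic fixed point of multiplier $e^{2\pi i p/q}$, $q$ odd. *)

theory Defs
  imports "HOL-Analysis.Analysis" "HOL-Library.Landau_Symbols"
begin

text \<open>C-infinity smoothness on an open set S: there is a family of functions containing f,
  closed under taking directional (Frechet) derivatives in every direction, all of whose
  members are differentiable on S. (All iterated derivatives exist.)\<close>
definition smooth_on :: "'a::real_normed_vector set \<Rightarrow> ('a \<Rightarrow> 'b::real_normed_vector) \<Rightarrow> bool" where
  "smooth_on S f \<longleftrightarrow> (\<exists>F. f \<in> F \<and> (\<forall>g\<in>F. g differentiable_on S \<and>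
       (\<forall>v. (\<lambda>x. frechet_derivative g (at x) v) \<in> F)))"

text \<open>Planar vector field V on C = R^2 (z = x + i y). Jacobian matrix at z0, with rows
  (Re V, Im V) and columns (d/dx, d/dy), viewed as a complex 2x2 matrix so that its
  (possibly complex) eigenvalues can be spoken of.\<close>
definition jacobian :: "(complex \<Rightarrow> complex) \<Rightarrow> complex \<Rightarrow> complex^2^2" where
  "jacobian V z0 = (let L = frechet_derivative V (at z0) in
     vector [vector [complex_of_real (Re (L 1)), complex_of_real (Re (L \<i>))],
             vector [complex_of_real (Im (L 1)), complex_of_real (Im (L \<i>))]])"

definition divergence :: "(complex \<Rightarrow> complex) \<Rightarrow> complex \<Rightarrow> real" where
  "divergence V z0 = (let L = frechet_derivative V (at z0) in Re (L 1) + Im (L \<i>))"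

definition is_eigenvalue :: "complex^2^2 \<Rightarrow> complex \<Rightarrow> bool" where
  "is_eigenvalue A lam \<longleftrightarrow> (\<exists>v. v \<noteq> 0 \<and> A *v v = lam *s v)"

definition nondegenerate_equilibrium :: "(complex \<Rightarrow> complex) \<Rightarrow> complex \<Rightarrow> bool" where
  "nondegenerate_equilibrium V z0 \<longleftrightarrow> V z0 = 0 \<and> V differentiable (at z0) \<and> det (jacobian V z0) \<noteq> 0"

definition is_center :: "(complex \<Rightarrow> complex) \<Rightarrow> complex \<Rightarrow> bool" where
  "is_center V z0 \<longleftrightarrow> nondegenerate_equilibrium V z0 \<and>
     (\<forall>lam. is_eigenvalue (jacobian V z0) lam \<longrightarrow> Re lam = 0 \<and> lam \<noteq> 0)"

definition is_saddle :: "(complex \<Rightarrow> complex) \<Rightarrow> complex \<Rightarrow> bool" where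
  "is_saddle V z0 \<longleftrightarrow> V z0 = 0 \<and> V differentiable (at z0) \<and>
     (\<forall>lam. is_eigenvalue (jacobian V z0) lam \<longrightarrow> Im lam = 0) \<and>
     (\<exists>l1 l2. is_eigenvalue (jacobian V z0) l1 \<and> is_eigenvalue (jacobian V z0) l2 \<and>
        Re l1 < 0 \<and> 0 < Re l2)"

end

theory Submission
  imports Defs
begin

text \<open>
  Put \<open>s = - \<mu> / l1\<close>. For \<open>z \<noteq> 0\<close> the equation \<open>V \<mu> z = 0\<close> reads
  \<open>\<mu> + \<Phi>(\<bar>z\<bar>\<^sup>2) + \<alpha> (z*)^(2q-1) / z + R / (\<i> z) = 0\<close>: its real part forces
  \<open>\<bar>z\<bar>\<^sup>2 = s + O(s\<^sup>2)\<close> (so \<open>s > 0\<close>), its imaginary part forces \<open>sin (2 q arg z) = O(s)\<close>. Hence every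
  equilibrium near 0 has the form \<open>z = sqrt s * exp (\<zeta> + \<i> k \<pi> / (2 q))\<close> with \<open>\<zeta>\<close> small. In the
  coordinate \<open>\<zeta>\<close> the left-hand side, with its real part divided by \<open>2 l1 s\<close> and its imaginary part by
  \<open>- 2 q \<alpha> (-1)^k s^(q-1)\<close>, is \<open>C\<^sup>1\<close>-close to the identity, so that a contraction argument gives
  exactly one zero \<open>\<zeta> = O(s)\<close> for each \<open>k\<close>. At this zero the Jacobian determinant of the field has the
  sign of the product of the two scaling factors, that is of \<open>- l1 \<alpha> (-1)^k\<close>; as the trace vanishes,
  this sign decides between saddle and center. The derivative of \<open>R\<close> in \<open>z\<close> is \<open>O(\<bar>z\<bar>^(2q))\<close> by an
  inequality of Landau-Kolmogorov type along lines.
\<close>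

section \<open>Derivatives of small smooth functions\<close>

text \<open>Equivalence of norms on the polynomials of degree at most \<open>n\<close>, made
  explicit by induction on the degree: comparing the polynomial with its dilate by 1/2 removes the
  top coefficient at a bounded cost.\<close>

lemma linear_coeff_bound:
  assumes "n \<ge> 1"
  shows "\<exists>K>0. \<forall>(a::nat \<Rightarrow> real) B. (\<forall>x\<in>{0..1}. \<bar>\<Sum>m\<le>n. a m * x ^ m\<bar> \<le> B) \<longrightarrow> \<bar>a 1\<bar> \<le> K * B"
  using assms
proof (induction n rule: dec_induct)
  case base
  show ?case
  proof (intro exI[of _ 2] conjI allI impI)
    fix a :: "nat \<Rightarrow> real" and B
    assume *: "\<forall>x\<in>{0..1}. \<bar>\<Sum>m\<le>1. a m * x ^ m\<bar> \<le> B"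
    from bspec[OF *, of 0] bspec[OF *, of 1] show "\<bar>a 1\<bar> \<le> 2 * B" by simp
  qed simp
next
  case (step n)
  then obtain K where K: "K > 0"
    and KB: "\<And>(a::nat \<Rightarrow> real) B. \<forall>x\<in>{0..1}. \<bar>\<Sum>m\<le>n. a m * x ^ m\<bar> \<le> B \<Longrightarrow> \<bar>a 1\<bar> \<le> K * B"
    by blast
  show ?case
  proof (intro exI[of _ "K * (1 + 2 ^ Suc n)"] conjI allI impI)
    fix a :: "nat \<Rightarrow> real" and B
    assume *: "\<forall>x\<in>{0..1}. \<bar>\<Sum>m\<le>Suc n. a m * x ^ m\<bar> \<le> B"
    \<comment> \<open>\<open>P(x) - 2^(n+1) P(x/2)\<close> has degree at most \<open>n\<close>: the top coefficient cancels.\<close>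
    define b where "b m = a m * (1 - 2 ^ Suc n / 2 ^ m)" for m
    have "\<bar>\<Sum>m\<le>n. b m * x ^ m\<bar> \<le> (1 + 2 ^ Suc n) * B" if x: "x \<in> {0..1}" for x
    proof -
      have "(\<Sum>m\<le>n. b m * x ^ m) = (\<Sum>m\<le>Suc n. b m * x ^ m)"
        by (simp add: b_def)
      also have "\<dots> = (\<Sum>m\<le>Suc n. a m * x ^ m) - 2 ^ Suc n * (\<Sum>m\<le>Suc n. a m * (x / 2) ^ m)"
        unfolding sum_distrib_left sum_subtractf[symmetric]
        by (intro sum.cong) (auto simp: b_def power_divide field_simps)
      finally have "\<bar>\<Sum>m\<le>n. b m * x ^ m\<bar> \<le>
          \<bar>\<Sum>m\<le>Suc n. a m * x ^ m\<bar> + 2 ^ Suc n * \<bar>\<Sum>m\<le>Suc n. a m * (x / 2) ^ m\<bar>"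
        using abs_triangle_ineq4 [of "\<Sum>m\<le>Suc n. a m * x ^ m"
            "2 ^ Suc n * (\<Sum>m\<le>Suc n. a m * (x / 2) ^ m)"] by (simp add: abs_mult)
      also have "\<dots> \<le> B + 2 ^ Suc n * B"
        using bspec[OF *, of x] bspec[OF *, of "x / 2"] x by (intro add_mono mult_left_mono) auto
      finally show ?thesis by (simp add: algebra_simps)
    qed
    from KB[of b, OF ballI[OF this]] have "\<bar>b 1\<bar> \<le> K * ((1 + 2 ^ Suc n) * B)" .
    moreover have "\<bar>a 1\<bar> \<le> \<bar>b 1\<bar>"
    proof -
      \<comment> \<open>The linear coefficient has been multiplied by
        \<open>1 - 2 ^ Suc n / 2 = 1 - 2 ^ n\<close>, of modulus at least 1 because \<open>n\<close>
        is positive.\<close>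
      have "(2::real) ^ n \<ge> 2 ^ 1" using step by (intro power_increasing) auto
      then have "1 \<le> \<bar>1 - (2::real) ^ n\<bar>" by simp
      then have "\<bar>a 1\<bar> * 1 \<le> \<bar>a 1\<bar> * \<bar>1 - 2 ^ n\<bar>" by (intro mult_left_mono) auto
      then show ?thesis by (simp add: b_def abs_mult)
    qed
    ultimately show "\<bar>a 1\<bar> \<le> K * (1 + 2 ^ Suc n) * B" by (simp add: mult.assoc)
  next
    show "0 < K * (1 + 2 ^ Suc n)" using K by (simp add: add_pos_pos)
  qed
qed

text \<open>The Taylor polynomial of degree \<open>n\<close> differs from the function by at most
  the Lagrange remainder, hence is bounded by \<open>B + M * r ^ Suc n\<close>, and this controls
  its linear coefficient. \<open>K\<close> depends on \<open>n\<close> alone, so \<open>r\<close>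
  may later vary with the point.\<close>

lemma landau_kolmogorov:
  assumes "n \<ge> 1"
  shows "\<exists>K>0. \<forall>(D::nat \<Rightarrow> real \<Rightarrow> real) r B M. r > 0 \<longrightarrow>
    (\<forall>m x. (D m has_real_derivative D (Suc m) x) (at x)) \<longrightarrow>
    (\<forall>x. \<bar>x\<bar> \<le> r \<longrightarrow> \<bar>D 0 x\<bar> \<le> B) \<longrightarrow> (\<forall>x. \<bar>x\<bar> \<le> r \<longrightarrow> \<bar>D (Suc n) x\<bar> \<le> M) \<longrightarrow>
    \<bar>D 1 0\<bar> * r \<le> K * (B + M * r ^ Suc n)"
proof -
  obtain K where K: "K > 0"
    and KB: "\<And>(a::nat \<Rightarrow> real) B. \<forall>x\<in>{0..1}. \<bar>\<Sum>m\<le>n. a m * x ^ m\<bar> \<le> B \<Longrightarrow> \<bar>a 1\<bar> \<le> K * B"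
    using linear_coeff_bound[OF assms] by blast
  show ?thesis
  proof (intro exI[of _ K] conjI K allI impI)
    fix D :: "nat \<Rightarrow> real \<Rightarrow> real" and r B M :: real
    assume r: "r > 0" and D: "\<forall>m x. (D m has_real_derivative D (Suc m) x) (at x)"
      and B: "\<forall>x. \<bar>x\<bar> \<le> r \<longrightarrow> \<bar>D 0 x\<bar> \<le> B" and M: "\<forall>x. \<bar>x\<bar> \<le> r \<longrightarrow> \<bar>D (Suc n) x\<bar> \<le> M"
    \<comment> \<open>Taylor coefficients in the rescaled variable: the argument is
      \<open>r * x\<close> with \<open>x\<close> in [0, 1].\<close>
    define a where "a m = D m 0 / fact m * r ^ m" for m
    have M0: "0 \<le> M" using M[rule_format, of 0] r by simp
    have "\<bar>\<Sum>m\<le>n. a m * x ^ m\<bar> \<le> B + M * r ^ Suc n" if x: "x \<in> {0..1}" for x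
    proof -
      from Maclaurin_all_le[OF refl D, of "r * x" "Suc n"] obtain t where
        t: "\<bar>t\<bar> \<le> \<bar>r * x\<bar>"
        and eq: "D 0 (r * x) = (\<Sum>m<Suc n. D m 0 / fact m * (r * x) ^ m)
           + D (Suc n) t / fact (Suc n) * (r * x) ^ Suc n" by blast
      have rx: "\<bar>r * x\<bar> \<le> r" using x r by (simp add: abs_mult mult_left_le)
      have "(\<Sum>m\<le>n. a m * x ^ m) = D 0 (r * x) - D (Suc n) t / fact (Suc n) * (r * x) ^ Suc n"
        unfolding eq a_def lessThan_Suc_atMost by (simp add: power_mult_distrib mult.assoc)
      also have "\<bar>\<dots>\<bar> \<le> \<bar>D 0 (r * x)\<bar> + \<bar>D (Suc n) t / fact (Suc n) * (r * x) ^ Suc n\<bar>"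
        by (rule abs_triangle_ineq4)
      also have "\<dots> \<le> B + M * r ^ Suc n"
      proof (rule add_mono)
        show "\<bar>D 0 (r * x)\<bar> \<le> B" using B rx by blast
        have "\<bar>D (Suc n) t / fact (Suc n)\<bar> \<le> M / 1"
          unfolding abs_divide using M t rx M0 by (intro frac_le) (auto simp del: fact_Suc)
        moreover have "\<bar>(r * x) ^ Suc n\<bar> \<le> r ^ Suc n"
          unfolding power_abs using rx by (intro power_mono) auto
        ultimately show "\<bar>D (Suc n) t / fact (Suc n) * (r * x) ^ Suc n\<bar> \<le> M * r ^ Suc n"
          unfolding abs_mult using M0 by (intro mult_mono) auto
      qed
      finally show ?thesis .
    qed
    from KB[of a, OF ballI[OF this]] show "\<bar>D 1 0\<bar> * r \<le> K * (B + M * r ^ Suc n)"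
      using r by (simp add: a_def abs_mult)
  qed
qed

text \<open>The family witnessing \<open>smooth_on\<close> is closed under directional derivatives,
  so iterating in one fixed direction never leaves it.\<close>

lemma smooth_on_iterated_directional:
  fixes f :: "'a::real_normed_vector \<Rightarrow> 'b::real_normed_vector"
  assumes "smooth_on UNIV f"
  obtains D :: "nat \<Rightarrow> 'a \<Rightarrow> 'b" where "D 0 = f" "\<And>m x. D m differentiable at x"
    "\<And>m x. D (Suc m) x = frechet_derivative (D m) (at x) v"
proof -
  from assms obtain F where F: "f \<in> F" "\<And>g. g \<in> F \<Longrightarrow> g differentiable_on UNIV"
    "\<And>g. g \<in> F \<Longrightarrow> (\<lambda>x. frechet_derivative g (at x) v) \<in> F" unfolding smooth_on_def by blast
  define D where "D = rec_nat f (\<lambda>_ g x. frechet_derivative g (at x) v)"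
  have D0: "D 0 = f" and DS: "\<And>m. D (Suc m) = (\<lambda>x. frechet_derivative (D m) (at x) v)"
    by (simp_all add: D_def)
  have "D m \<in> F" for m by (induction m) (auto simp: D0 DS F)
  then have "D m differentiable at x" for m x using F(2)[of "D m"] by (simp add: differentiable_on_def)
  with D0 DS show ?thesis by (intro that[of D]) auto
qed

text \<open>The preceding inequality is used on the line through \<open>z\<close> in direction
  \<open>v\<close>, with \<open>r = norm z\<close>. There \<open>R\<close> is
  \<open>O(norm z ^ (n + 1))\<close> and its derivative of order \<open>n + 1\<close> is bounded, so
  dividing by \<open>r\<close> costs exactly one power of \<open>norm z\<close>.\<close>

lemma directional_derivative_small:
  fixes R :: "real \<times> complex \<Rightarrow> complex"
  assumes R: "smooth_on UNIV R" and n: "n \<ge> 1" and \<delta>: "\<delta> > 0" and v: "norm v = 1"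
    and small: "\<And>\<mu> z. \<bar>\<mu>\<bar> < \<delta> \<Longrightarrow> norm z < \<delta> \<Longrightarrow> norm (R (\<mu>, z)) \<le> C * norm z ^ Suc n"
  shows "\<exists>C'. \<forall>\<mu> z. \<bar>\<mu>\<bar> < \<delta> / 2 \<and> norm z < \<delta> / 2 \<and> z \<noteq> 0 \<longrightarrow>
    norm (frechet_derivative R (at (\<mu>, z)) (0, v)) \<le> C' * norm z ^ n"
proof -
  obtain D where D: "D 0 = R" "\<And>m x. D m differentiable at x"
    "\<And>m x. D (Suc m) x = frechet_derivative (D m) (at x) (0, v)"
    by (rule smooth_on_iterated_directional[OF R, of "(0, v)"]) simp
  obtain K where K: "K > 0" and KB: "\<And>(D::nat \<Rightarrow> real \<Rightarrow> real) r B M. r > 0 \<Longrightarrow>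
    (\<And>m x. (D m has_real_derivative D (Suc m) x) (at x)) \<Longrightarrow>
    (\<And>x. \<bar>x\<bar> \<le> r \<Longrightarrow> \<bar>D 0 x\<bar> \<le> B) \<Longrightarrow> (\<And>x. \<bar>x\<bar> \<le> r \<Longrightarrow> \<bar>D (Suc n) x\<bar> \<le> M) \<Longrightarrow>
    \<bar>D 1 0\<bar> * r \<le> K * (B + M * r ^ Suc n)"
    using landau_kolmogorov[OF n] by metis
  \<comment> \<open>Compactness in both variables makes the bound \<open>M\<close> uniform in
    \<mu>.\<close>
  have "compact (D (Suc n) ` (cball 0 \<delta> \<times> cball 0 \<delta>))"
    by (intro compact_continuous_image compact_Times compact_cball)
       (meson D(2) continuous_at_imp_continuous_on differentiable_imp_continuous_within)
  then obtain M where M: "\<And>\<mu> z. \<bar>\<mu>\<bar> \<le> \<delta> \<Longrightarrow> norm z \<le> \<delta> \<Longrightarrow> norm (D (Suc n) (\<mu>, z)) \<le> M"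
    using compact_imp_bounded[THEN bounded_iff[THEN iffD1]] by fastforce
  have line: "((\<lambda>x. D m (\<mu>, z + of_real x * v)) has_vector_derivative
        D (Suc m) (\<mu>, z + of_real x * v)) (at x)" for m \<mu> z x
  proof -
    have "((\<lambda>x. (\<mu>, z + of_real x * v)) has_derivative (\<lambda>h. (0, of_real h * v))) (at x)"
      by (auto intro!: derivative_eq_intros)
    moreover have "(D m has_derivative frechet_derivative (D m) (at (\<mu>, z + of_real x * v)))
        (at (\<mu>, z + of_real x * v))" using D(2) frechet_derivative_works by blast
    ultimately have "((\<lambda>x. D m (\<mu>, z + of_real x * v)) has_derivative
        (\<lambda>h. frechet_derivative (D m) (at (\<mu>, z + of_real x * v)) (0, of_real h * v))) (at x)"
      using diff_chain_at[of _ _ x "D m"] by (simp add: o_def)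
    moreover have "frechet_derivative (D m) (at (\<mu>, z + of_real x * v)) (0, of_real h * v)
        = h *\<^sub>R D (Suc m) (\<mu>, z + of_real x * v)" for h
    proof -
      have "(0, of_real h * v) = h *\<^sub>R (0::real, v)" by (simp add: scaleR_conv_of_real)
      then show ?thesis by (simp only: D(3) linear_cmul[OF linear_frechet_derivative[OF D(2)]])
    qed
    ultimately show ?thesis unfolding has_vector_derivative_def by (simp only:)
  qed
  show ?thesis
  proof (intro exI[of _ "2 * K * (C * 2 ^ Suc n + M)"] allI impI)
    fix \<mu> :: real and z :: complex
    assume *: "\<bar>\<mu>\<bar> < \<delta> / 2 \<and> norm z < \<delta> / 2 \<and> z \<noteq> 0"
    \<comment> \<open>The segment stays in the ball of radius \<open>2 * norm z\<close>; hence the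
      restriction to half of \<delta> and the factor \<open>2 ^ Suc n\<close> in the
      constant.\<close>
    have nz: "norm (z + of_real x * v) \<le> 2 * norm z" if "\<bar>x\<bar> \<le> norm z" for x
      using norm_triangle_ineq[of z "of_real x * v"] that v by (simp add: norm_mult)
    have C: "0 \<le> C"
    proof -
      have "0 \<le> C * norm z ^ Suc n" 
        using small[of \<mu> z] * order_trans[OF norm_ge_zero] \<delta> by auto
      then show ?thesis using * by (meson mult_neg_pos not_le zero_less_norm_iff zero_less_power)
    qed
    have Bd: "norm (D 0 (\<mu>, z + of_real x * v)) \<le> C * (2 * norm z) ^ Suc n" if "\<bar>x\<bar> \<le> norm z" for x
    proof -
      have "norm (D 0 (\<mu>, z + of_real x * v)) \<le> C * norm (z + of_real x * v) ^ Suc n"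
        unfolding D(1) using * nz[OF that] by (intro small) auto
      also have "\<dots> \<le> C * (2 * norm z) ^ Suc n"
        using nz[OF that] C by (intro mult_left_mono power_mono) auto
      finally show ?thesis .
    qed
    have Md: "norm (D (Suc n) (\<mu>, z + of_real x * v)) \<le> M" if "\<bar>x\<bar> \<le> norm z" for x
      using * nz[OF that] by (intro M) auto
    \<comment> \<open>The inequality concerns real functions, so it is applied to the components
      \<open>T = Re\<close> and \<open>T = Im\<close>; adding the two gives the factor 2 in the
      constant.\<close>
    have bound: "\<bar>T (D 1 (\<mu>, z))\<bar> * norm z \<le> K * (C * (2 * norm z) ^ Suc n + M * norm z ^ Suc n)"
      if T: "bounded_linear T" "\<And>w. \<bar>T w\<bar> \<le> norm w" for T :: "complex \<Rightarrow> real"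
    proof -
      have "\<bar>T (D 1 (\<mu>, z + of_real 0 * v))\<bar> * norm z
          \<le> K * (C * (2 * norm z) ^ Suc n + M * norm z ^ Suc n)"
      proof (rule KB)
        show "norm z > 0" using * by simp
        show "((\<lambda>x. T (D m (\<mu>, z + of_real x * v))) has_real_derivative
            T (D (Suc m) (\<mu>, z + of_real x * v))) (at x)" for m x
          using bounded_linear.has_vector_derivative[OF T(1) line]
          by (simp only: has_real_derivative_iff_has_vector_derivative)
      qed (rule order_trans[OF T(2) Bd] order_trans[OF T(2) Md], assumption)+
      then show ?thesis by simp
    qed
    have "norm (D 1 (\<mu>, z)) * norm z \<le> \<bar>Re (D 1 (\<mu>, z))\<bar> * norm z + \<bar>Im (D 1 (\<mu>, z))\<bar> * norm z"
      using mult_right_mono[OF cmod_le[of "D 1 (\<mu>, z)"], of "norm z"] by (simp add: algebra_simps)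
    also have "\<dots> \<le> 2 * (K * (C * (2 * norm z) ^ Suc n + M * norm z ^ Suc n))"
      using bound[OF bounded_linear_Re abs_Re_le_cmod] bound[OF bounded_linear_Im abs_Im_le_cmod]
      by linarith
    also have "\<dots> = 2 * K * (C * 2 ^ Suc n + M) * norm z ^ n * norm z"
      by (simp add: power_mult_distrib algebra_simps)
    finally have "norm (D 1 (\<mu>, z)) \<le> 2 * K * (C * 2 ^ Suc n + M) * norm z ^ n"
      using * by (simp only: mult_le_cancel_right) auto
    then show "norm (frechet_derivative R (at (\<mu>, z)) (0, v)) \<le> 2 * K * (C * 2 ^ Suc n + M) * norm z ^ n"
      using D(1,3) by simp
  qed
qed

text \<open>By real linearity of the derivative, the directions 1 and \<open>\<i>\<close>
  suffice.\<close>

lemma partial_derivative_small: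
  fixes R :: "real \<times> complex \<Rightarrow> complex"
  assumes R: "smooth_on UNIV R" and n: "n \<ge> 1" and \<delta>: "\<delta> > 0"
    and small: "\<And>\<mu> z. \<bar>\<mu>\<bar> < \<delta> \<Longrightarrow> norm z < \<delta> \<Longrightarrow> norm (R (\<mu>, z)) \<le> C * norm z ^ Suc n"
  shows "\<exists>C'\<ge>0. \<forall>\<mu> z w. \<bar>\<mu>\<bar> < \<delta> / 2 \<and> norm z < \<delta> / 2 \<and> z \<noteq> 0 \<longrightarrow>
    norm (frechet_derivative R (at (\<mu>, z)) (0, w)) \<le> C' * norm z ^ n * norm w"
proof -
  obtain C1 where C1: "\<And>\<mu> z. \<bar>\<mu>\<bar> < \<delta> / 2 \<Longrightarrow> norm z < \<delta> / 2 \<Longrightarrow> z \<noteq> 0 \<Longrightarrow>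
    norm (frechet_derivative R (at (\<mu>, z)) (0, 1)) \<le> C1 * norm z ^ n"
    using directional_derivative_small[OF R n \<delta> norm_one small] by blast
  obtain C2 where C2: "\<And>\<mu> z. \<bar>\<mu>\<bar> < \<delta> / 2 \<Longrightarrow> norm z < \<delta> / 2 \<Longrightarrow> z \<noteq> 0 \<Longrightarrow>
    norm (frechet_derivative R (at (\<mu>, z)) (0, \<i>)) \<le> C2 * norm z ^ n"
    using directional_derivative_small[OF R n \<delta> norm_ii small] by blast
  have diff: "R differentiable at x" for x
    using R unfolding smooth_on_def differentiable_on_def by blast
  show ?thesis
  proof (intro exI[of _ "\<bar>C1\<bar> + \<bar>C2\<bar>"] conjI allI impI)
    fix \<mu> :: real and z w :: complex
    assume *: "\<bar>\<mu>\<bar> < \<delta> / 2 \<and> norm z < \<delta> / 2 \<and> z \<noteq> 0"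
    let ?L = "frechet_derivative R (at (\<mu>, z))"
    have "(0, w) = Re w *\<^sub>R (0::real, 1) + Im w *\<^sub>R (0, \<i>)"
      by (simp add: complex_eq_iff)
    then have "?L (0, w) = Re w *\<^sub>R ?L (0, 1) + Im w *\<^sub>R ?L (0, \<i>)"
      by (simp only: linear_add[OF linear_frechet_derivative[OF diff]]
          linear_cmul[OF linear_frechet_derivative[OF diff]])
    then have "norm (?L (0, w)) \<le> \<bar>Re w\<bar> * norm (?L (0, 1)) + \<bar>Im w\<bar> * norm (?L (0, \<i>))"
      by (metis norm_scaleR norm_triangle_ineq)
    also have "\<dots> \<le> norm w * (\<bar>C1\<bar> * norm z ^ n) + norm w * (\<bar>C2\<bar> * norm z ^ n)"
    proof (intro add_mono mult_mono abs_Re_le_cmod abs_Im_le_cmod)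
      show "norm (?L (0, 1)) \<le> \<bar>C1\<bar> * norm z ^ n"
        using * by (intro order_trans[OF C1] mult_right_mono) auto
      show "norm (?L (0, \<i>)) \<le> \<bar>C2\<bar> * norm z ^ n"
        using * by (intro order_trans[OF C2] mult_right_mono) auto
    qed auto
    finally show "norm (?L (0, w)) \<le> (\<bar>C1\<bar> + \<bar>C2\<bar>) * norm z ^ n * norm w"
      by (simp add: algebra_simps)
  qed simp
qed

section \<open>Elementary facts on continuity and differentiability\<close>

lemma isCont_norm_bound:
  fixes f :: "'a::real_normed_vector \<Rightarrow> 'b::real_normed_vector"
  assumes "isCont f a" "e > 0"
  shows "\<exists>d>0. \<forall>x. norm (x - a) < d \<longrightarrow> norm (f x - f a) \<le> e"
  using assms unfolding continuous_at_eps_delta dist_norm by (meson less_imp_le)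

text \<open>Lets terms of order two or more be dropped from a derivative at 0, both for the field at
  the origin and for \<Phi>.\<close>

lemma has_derivative_zero_of_quadratic:
  fixes f :: "'a::real_normed_vector \<Rightarrow> 'b::real_normed_vector"
  assumes d: "d > 0" and f: "\<And>z. norm z < d \<Longrightarrow> norm (f z) \<le> M * (norm z)\<^sup>2"
  shows "(f has_derivative (\<lambda>_. 0)) (at 0)"
  unfolding has_derivative_at_alt
proof (intro conjI allI impI)
  fix e :: real assume e: "e > 0"
  have "f 0 = 0" using f[of 0] d by simp
  have "norm (f z) \<le> e * norm z" if z: "norm z < min d (e / (\<bar>M\<bar> + 1))" for z
  proof -
    have "norm z * (\<bar>M\<bar> + 1) \<le> e" using z by (simp add: field_simps)
    moreover have "norm z * M \<le> norm z * (\<bar>M\<bar> + 1)" by (intro mult_left_mono) auto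
    ultimately have "norm z * (norm z * M) \<le> norm z * e" by (intro mult_left_mono) auto
    then show ?thesis using f[of z] z by (simp add: power2_eq_square mult_ac)
  qed
  then show "\<exists>d>0. \<forall>y. norm (y - 0) < d \<longrightarrow> norm (f y - f 0 - 0) \<le> e * norm (y - 0)"
    using d e \<open>f 0 = 0\<close> by (intro exI[of _ "min d (e / (\<bar>M\<bar> + 1))"]) auto
qed simp

section \<open>Type of an equilibrium with vanishing divergence\<close>

text \<open>The determinant of a real linear map of the plane with columns \<open>L 1\<close> and
  \<open>L \<i>\<close>, in a form suited to complex multiplication.\<close>

definition rdet :: "(complex \<Rightarrow> complex) \<Rightarrow> real" where
  "rdet L = Im (cnj (L 1) * L \<i>)"

lemma linear_complex_expand:
  fixes L :: "complex \<Rightarrow> complex"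
  assumes "linear L"
  shows "L w = of_real (Re w) * L 1 + of_real (Im w) * L \<i>"
proof -
  have "w = Re w *\<^sub>R 1 + Im w *\<^sub>R \<i>" by (simp add: complex_eq_iff)
  then show ?thesis using assms by (metis linear_add linear_cmul scaleR_conv_of_real)
qed

text \<open>Multiplication by a complex number has as real determinant the square of its modulus, so
  the contributions of \<open>\<i> * z\<close> and of \<open>1 / z\<close> cancel.\<close>

lemma rdet_conjugate:
  assumes "linear H" and "z \<noteq> 0"
  shows "rdet (\<lambda>w. \<i> * z * H (w / z)) = rdet H"
proof -
  define u where "u = 1 / z"
  have u: "H (1 / z) = of_real (Re u) * H 1 + of_real (Im u) * H \<i>"
    unfolding u_def by (rule linear_complex_expand[OF assms(1)])
  have iu: "H (\<i> / z) = - of_real (Im u) * H 1 + of_real (Re u) * H \<i>"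
    using linear_complex_expand[OF assms(1), of "\<i> * u"]
    by (simp only: times_complex.sel) (simp add: u_def)
  have "rdet (\<lambda>w. \<i> * z * H (w / z)) = Im (z * cnj z * (cnj (H (1 / z)) * H (\<i> / z)))"
    unfolding rdet_def by (simp only: complex_cnj_mult) (simp add: algebra_simps)
  also have "\<dots> = (norm z)\<^sup>2 * Im (cnj (H (1 / z)) * H (\<i> / z))"
    by (simp add: complex_mult_cnj cmod_power2)
  also have "Im (cnj (H (1 / z)) * H (\<i> / z)) = ((Re u)\<^sup>2 + (Im u)\<^sup>2) * rdet H"
    unfolding u iu rdet_def by (simp add: algebra_simps power2_eq_square)
  also have "(Re u)\<^sup>2 + (Im u)\<^sup>2 = 1 / (norm z)\<^sup>2"
    using cmod_power2[of u] by (simp add: u_def norm_divide power_divide)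
  finally show ?thesis using assms(2) by simp
qed

text \<open>The columns differ from 1 and \<open>\<i>\<close> by at most 1/4, so the determinant is
  at least 1 - 1/4 - 1/4 - 1/16.\<close>

lemma rdet_pos_of_near_id:
  assumes "\<And>w. norm (w - L w) \<le> norm w / 4"
  shows "rdet L > 0"
proof -
  define x where "x = 1 - L 1"
  define y where "y = \<i> - L \<i>"
  have x: "norm x \<le> 1 / 4" and y: "norm y \<le> 1 / 4"
    using assms[of 1] assms[of \<i>] by (simp_all add: x_def y_def)
  have "rdet L = Im (cnj (1 - x) * (\<i> - y))" by (simp add: rdet_def x_def y_def)
  also have "\<dots> = 1 - Im y - Re x + Im (cnj x * y)" by (simp add: algebra_simps)
  finally have "rdet L = 1 - Im y - Re x + Im (cnj x * y)" .
  moreover have "\<bar>Im (cnj x * y)\<bar> \<le> 1 / 4 * (1 / 4)"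
    using abs_Im_le_cmod[of "cnj x * y"] mult_mono[OF x y] by (simp add: norm_mult)
  ultimately show ?thesis
    using abs_Re_le_cmod[of x] abs_Im_le_cmod[of y] x y by linarith
qed

lemma det_jacobian: "det (jacobian V z) = of_real (rdet (frechet_derivative V (at z)))"
  by (simp add: jacobian_def Let_def det_2 rdet_def complex_eq_iff)

text \<open>The trace vanishes, so the characteristic polynomial is \<open>\<lambda>\<^sup>2 + det\<close>.\<close>

lemma is_eigenvalue_jacobian_iff:
  assumes "divergence V z = 0"
  shows "is_eigenvalue (jacobian V z) lam \<longleftrightarrow> lam\<^sup>2 = - of_real (rdet (frechet_derivative V (at z)))"
proof -
  define L where "L = frechet_derivative V (at z)"
  define p b c where "p = complex_of_real (Re (L 1))" and "b = complex_of_real (Re (L \<i>))"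
    and "c = complex_of_real (Im (L 1))"
  have tr: "Im (L \<i>) = - Re (L 1)"
    using assms by (simp add: divergence_def Let_def L_def)
  then have J: "jacobian V z = vector [vector [p, b], vector [c, - p]]"
    by (simp add: jacobian_def Let_def L_def[symmetric] p_def b_def c_def)
  have d: "- of_real (rdet L) = p\<^sup>2 + b * c"
    using tr by (simp add: rdet_def p_def b_def c_def power2_eq_square complex_eq_iff)
  have ev: "is_eigenvalue (jacobian V z) lam \<longleftrightarrow>
      (\<exists>x y. (x \<noteq> 0 \<or> y \<noteq> 0) \<and> p * x + b * y = lam * x \<and> c * x - p * y = lam * y)" (is "_ \<longleftrightarrow> ?R")
  proof
    assume "is_eigenvalue (jacobian V z) lam"
    then obtain v where "v \<noteq> 0" "jacobian V z *v v = lam *s v" by (auto simp: is_eigenvalue_def)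
    then show ?R
      by (intro exI[of _ "v $ 1"] exI[of _ "v $ 2"])
         (auto simp: J vec_eq_iff forall_2 matrix_vector_mult_def sum_2)
  next
    assume ?R
    then obtain x y where "x \<noteq> 0 \<or> y \<noteq> 0" "p * x + b * y = lam * x" "c * x - p * y = lam * y" by blast
    then show "is_eigenvalue (jacobian V z) lam" unfolding is_eigenvalue_def
      by (intro exI[of _ "vector [x, y]"])
         (auto simp: J vec_eq_iff forall_2 matrix_vector_mult_def sum_2)
  qed
  have "?R \<longleftrightarrow> lam\<^sup>2 = p\<^sup>2 + b * c"
  proof
    assume ?R
    then obtain x y where xy: "x \<noteq> 0 \<or> y \<noteq> 0" and 1: "p * x + b * y = lam * x"
      and 2: "c * x - p * y = lam * y" by blast
    have "(lam\<^sup>2 - (p\<^sup>2 + b * c)) * x = 0" "(lam\<^sup>2 - (p\<^sup>2 + b * c)) * y = 0"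
      using 1 2 by algebra+
    with xy show "lam\<^sup>2 = p\<^sup>2 + b * c" by auto
  next
    assume lam: "lam\<^sup>2 = p\<^sup>2 + b * c"
    \<comment> \<open>The vector \<open>(b, lam - p)\<close> lies in the kernel of the matrix minus
      \<open>lam\<close>. If it vanishes, \<open>(2 * p, c)\<close> does the job, and if that
      vanishes too, the matrix is zero.\<close>
    show ?R
    proof (cases "b = 0 \<and> lam = p")
      case False
      with lam show ?thesis
        by (intro exI[of _ b] exI[of _ "lam - p"]) (auto simp: algebra_simps power2_eq_square)
    next
      case True
      show ?thesis
      proof (cases "p = 0 \<and> c = 0")
        case True
        with \<open>b = 0 \<and> lam = p\<close> show ?thesis by (intro exI[of _ 1]) auto
      next
        case False
        with True show ?thesis
          by (intro exI[of _ "2 * p"] exI[of _ c]) (auto simp: algebra_simps)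
      qed
    qed
  qed
  with ev d show ?thesis by (simp add: L_def)
qed

text \<open>A positive determinant makes the square of \<open>lam\<close> a negative real, which
  excludes both a nonzero real part and \<open>lam = 0\<close>.\<close>

lemma is_center_of_rdet_pos:
  assumes "V z = 0" "V differentiable at z" "divergence V z = 0"
    "rdet (frechet_derivative V (at z)) > 0"
  shows "is_center V z"
  unfolding is_center_def nondegenerate_equilibrium_def
proof (intro conjI allI impI)
  fix lam assume "is_eigenvalue (jacobian V z) lam"
  then have "lam\<^sup>2 = - of_real (rdet (frechet_derivative V (at z)))"
    by (simp add: is_eigenvalue_jacobian_iff[OF assms(3)])
  then have *: "Re lam * Re lam - Im lam * Im lam = - rdet (frechet_derivative V (at z))"
    "Re lam * Im lam = 0"
    by (auto simp: complex_eq_iff power2_eq_square)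
  show "Re lam = 0"
  proof (rule ccontr)
    assume "Re lam \<noteq> 0"
    with * have "Re lam * Re lam < 0" using assms(4) by simp
    then show False by (simp add: mult_less_0_iff)
  qed
  show "lam \<noteq> 0" using * assms(4) by auto
qed (use assms in \<open>auto simp: det_jacobian\<close>)

text \<open>With a negative determinant the eigenvalues are the two real square roots of its
  negative.\<close>

lemma is_saddle_of_rdet_neg:
  assumes "V z = 0" "V differentiable at z" "divergence V z = 0"
    "rdet (frechet_derivative V (at z)) < 0"
  shows "is_saddle V z"
  unfolding is_saddle_def
proof (intro conjI allI impI)
  fix lam assume "is_eigenvalue (jacobian V z) lam"
  then have "lam\<^sup>2 = - of_real (rdet (frechet_derivative V (at z)))"
    by (simp add: is_eigenvalue_jacobian_iff[OF assms(3)])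
  then have *: "Re lam * Re lam - Im lam * Im lam = - rdet (frechet_derivative V (at z))"
    "Re lam * Im lam = 0"
    by (auto simp: complex_eq_iff power2_eq_square)
  show "Im lam = 0"
  proof (rule ccontr)
    assume "Im lam \<noteq> 0"
    with * have "Im lam * Im lam < 0" using assms(4) by simp
    then show False by (simp add: mult_less_0_iff)
  qed
next
  define t where "t = sqrt (- rdet (frechet_derivative V (at z)))"
  have "t > 0" "t\<^sup>2 = - rdet (frechet_derivative V (at z))"
    using assms(4) by (simp_all add: t_def)
  then show "\<exists>l1 l2. is_eigenvalue (jacobian V z) l1 \<and> is_eigenvalue (jacobian V z) l2 \<and>
        Re l1 < 0 \<and> 0 < Re l2"
    by (intro exI[of _ "- complex_of_real t"] exI[of _ "complex_of_real t"])
       (auto simp: is_eigenvalue_jacobian_iff[OF assms(3)] simp flip: of_real_power)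
qed (use assms in auto)

section \<open>The flow in logarithmic coordinates\<close>

text \<open>Subtracting the nearest multiple of \<open>pi\<close> puts \<open>y\<close> in the range
  where \<open>arcsin\<close> inverts \<open>sin\<close>, so that a small \<open>sin t\<close>
  forces a small \<open>y\<close>.\<close>

lemma nearest_zero_of_sin:
  obtains j :: int and y :: real where "t = of_int j * pi + y" "\<bar>y\<bar> \<le> pi / 2" "\<bar>sin t\<bar> = \<bar>sin y\<bar>"
proof -
  define j where "j = round (t / pi)"
  define y where "y = t - of_int j * pi"
  have "\<bar>of_int j - t / pi\<bar> * pi \<le> 1 / 2 * pi"
    unfolding j_def by (intro mult_right_mono of_int_round_abs_le) simp
  also have "\<bar>of_int j - t / pi\<bar> * pi = \<bar>(of_int j - t / pi) * pi\<bar>" by (simp add: abs_mult)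
  also have "(of_int j - t / pi) * pi = - y" by (simp add: y_def field_simps)
  finally have "\<bar>y\<bar> \<le> pi / 2" by simp
  moreover have t: "t = of_int j * pi + y" by (simp add: y_def)
  moreover have s: "sin (of_int j * pi) = 0" using sin_zero_iff_int2 by blast
  then have "\<bar>cos (of_int j * pi)\<bar> = 1" by (simp add: sin_zero_abs_cos_one)
  with s have "\<bar>sin t\<bar> = \<bar>sin y\<bar>" unfolding t sin_add by (simp add: abs_mult)
  ultimately show ?thesis using that by blast
qed

lemma abs_exp_minus_one_le:
  fixes x :: real
  assumes "\<bar>x\<bar> \<le> 1 / 2"
  shows "\<bar>exp x - 1\<bar> \<le> 2 * \<bar>x\<bar>"
proof -
  have "exp x \<le> 1 + 2 * \<bar>x\<bar>" using exp_bound_lemma[of x] assms by simp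
  then show ?thesis using exp_ge_add_one_self[of x] by linarith
qed

text \<open>Retains only first-order data: \<Phi> with its linear part and a derivative continuous
  at 0, and \<open>R\<close> with its derivative \<open>DR\<close> in \<open>z\<close>, both bounded
  with a common constant \<open>C\<close>. The bound \<delta> \<le> 1 allows higher powers of the
  radius to be replaced by lower ones.\<close>

locale garland_flow =
  fixes q :: nat and l1 \<alpha> :: real and \<Phi> \<Phi>' :: "real \<Rightarrow> real"
    and R :: "real \<Rightarrow> complex \<Rightarrow> complex" and DR :: "real \<Rightarrow> complex \<Rightarrow> complex \<Rightarrow> complex"
    and K C \<delta> :: real
  assumes q: "q \<ge> 3" and l1: "l1 \<noteq> 0" and \<alpha>: "\<alpha> \<noteq> 0"
    and \<Phi>: "\<And>s. (\<Phi> has_real_derivative \<Phi>' s) (at s)"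
    and \<Phi>'_0: "\<Phi>' 0 = l1" and \<Phi>'_cont: "isCont \<Phi>' 0"
    and \<delta>: "\<delta> > 0" "\<delta> \<le> 1" and K: "K \<ge> 0" and C: "C \<ge> 0"
    and \<Phi>_bound: "\<And>s. \<bar>s\<bar> < \<delta> \<Longrightarrow> \<bar>\<Phi> s - l1 * s\<bar> \<le> K * s\<^sup>2"
    and R: "\<And>\<mu> z. (R \<mu> has_derivative DR \<mu> z) (at z)"
    and R_bound: "\<And>\<mu> z. \<bar>\<mu>\<bar> < \<delta> \<Longrightarrow> norm z < \<delta> \<Longrightarrow> norm (R \<mu> z) \<le> C * norm z ^ (2 * q + 1)"
    and DR_bound: "\<And>\<mu> z w. \<bar>\<mu>\<bar> < \<delta> \<Longrightarrow> norm z < \<delta> \<Longrightarrow> z \<noteq> 0 \<Longrightarrow>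
      norm (DR \<mu> z w) \<le> C * norm z ^ (2 * q) * norm w"
begin

definition V :: "real \<Rightarrow> complex \<Rightarrow> complex" where
  "V \<mu> z = \<i> * complex_of_real \<mu> * z + \<i> * complex_of_real (\<Phi> ((norm z)\<^sup>2)) * z
         + \<i> * complex_of_real \<alpha> * (cnj z) ^ (2 * q - 1) + R \<mu> z"

text \<open>Logarithmic coordinates around the \<open>k\<close>-th expected equilibrium, at the parameter value
  \<open>\<mu> = - l1 * s\<close>; in them the field is \<open>\<i> z h(\<zeta>)\<close>.\<close>

definition chart :: "real \<Rightarrow> nat \<Rightarrow> complex \<Rightarrow> complex" where
  "chart s k \<zeta> = of_real (sqrt s) * exp (\<zeta> + of_real (real k * pi / (2 * real q)) * \<i>)"

text \<open>The quotient \<open>cnj z ^ (2 * q - 1) / z\<close> in the chart, stripped of the factor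
  \<open>(-1) ^ k * s ^ (q - 1)\<close>.\<close>

definition P :: "complex \<Rightarrow> complex" where
  "P \<zeta> = exp ((2 * of_nat q - 1) * cnj \<zeta> - \<zeta>)"

definition E :: "real \<Rightarrow> nat \<Rightarrow> complex \<Rightarrow> complex" where
  "E s k \<zeta> = R (- l1 * s) (chart s k \<zeta>) / (\<i> * chart s k \<zeta>)"

text \<open>The derivative of \<open>E s k\<close>: the chart differentiates to multiplication by
  its own value, so the denominator contributes just \<open>- E s k \<zeta> * w\<close>.\<close>

definition DE :: "real \<Rightarrow> nat \<Rightarrow> complex \<Rightarrow> complex \<Rightarrow> complex" where
  "DE s k \<zeta> w = DR (- l1 * s) (chart s k \<zeta>) (chart s k \<zeta> * w) / (\<i> * chart s k \<zeta>) - E s k \<zeta> * w"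

definition h :: "real \<Rightarrow> nat \<Rightarrow> complex \<Rightarrow> complex" where
  "h s k \<zeta> = of_real (- l1 * s + \<Phi> (s * exp (2 * Re \<zeta>)))
     + of_real (\<alpha> * (-1) ^ k * s ^ (q - 1)) * P \<zeta> + E s k \<zeta>"

definition Dh :: "real \<Rightarrow> nat \<Rightarrow> complex \<Rightarrow> complex \<Rightarrow> complex" where
  "Dh s k \<zeta> w = of_real (\<Phi>' (s * exp (2 * Re \<zeta>)) * (s * exp (2 * Re \<zeta>) * (2 * Re w)))
     + of_real (\<alpha> * (-1) ^ k * s ^ (q - 1)) * (P \<zeta> * ((2 * of_nat q - 1) * cnj w - w)) + DE s k \<zeta> w"

text \<open>The scaling is chosen so that \<open>scale s k \<circ> h s k\<close> tends to the identity as \<open>s\<close> and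
  \<open>\<zeta>\<close> tend to 0.\<close>

definition scale :: "real \<Rightarrow> nat \<Rightarrow> complex \<Rightarrow> complex" where
  "scale s k w = Complex (Re w / (2 * l1 * s)) (Im w / (- 2 * real q * \<alpha> * (-1) ^ k * s ^ (q - 1)))"

section \<open>Algebra of the chart and of the scaling\<close>

lemma chart_nonzero: "s > 0 \<Longrightarrow> chart s k \<zeta> \<noteq> 0"
  by (simp add: chart_def)

lemma norm_chart: "s > 0 \<Longrightarrow> norm (chart s k \<zeta>) = sqrt s * exp (Re \<zeta>)"
  by (simp add: chart_def norm_mult)

lemma norm_chart_squared: "s > 0 \<Longrightarrow> (norm (chart s k \<zeta>))\<^sup>2 = s * exp (2 * Re \<zeta>)"
  by (simp add: norm_chart power_mult_distrib exp_double)

lemma chart_direction: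
  "s > 0 \<Longrightarrow> chart s k \<zeta> / of_real (norm (chart s k \<zeta>)) = cis (Im \<zeta> + real k * pi / (2 * real q))"
  by (simp add: chart_def exp_eq_polar norm_mult)

lemma cnj_chart_power:
  assumes "s > 0"
  shows "cnj (chart s k \<zeta>) ^ (2 * q - 1) = chart s k \<zeta> * of_real ((-1) ^ k * s ^ (q - 1)) * P \<zeta>"
proof -
  define x where "x = real k * pi / (2 * real q)"
  have n: "of_nat (2 * q - 1) = 2 * of_nat q - (1::complex)"
    using q by (simp add: of_nat_diff)
  have "cnj (chart s k \<zeta>) = of_real (sqrt s) * exp (cnj \<zeta> - of_real x * \<i>)"
    by (simp add: chart_def x_def exp_cnj)
  then have "cnj (chart s k \<zeta>) ^ (2 * q - 1)
      = of_real (sqrt s ^ (2 * q - 1)) * exp ((2 * of_nat q - 1) * (cnj \<zeta> - of_real x * \<i>))"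
    by (simp only: power_mult_distrib of_real_power n[symmetric] exp_of_nat_mult)
  also have "sqrt s ^ (2 * q - 1) = sqrt s * s ^ (q - 1)"
  proof -
    have "2 * q - 1 = Suc (2 * (q - 1))" using q by simp
    then show ?thesis using assms by (simp add: power_mult)
  qed
  \<comment> \<open>The exponent splits into that of the chart, that of \<open>P\<close>, and
    \<open>- k * pi * \<i>\<close>, because \<open>2 * q\<close> times the angle \<open>x\<close> is
    \<open>k * pi\<close>. The last part produces the alternating sign.\<close>
  also have "(2 * of_nat q - 1) * (cnj \<zeta> - of_real x * \<i>)
      = (\<zeta> + of_real x * \<i>) + ((2 * of_nat q - 1) * cnj \<zeta> - \<zeta>) + (- of_nat k * (of_real pi * \<i>))"
  proof -
    have "2 * real q * x = real k * pi" using q by (simp add: x_def)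
    then have "2 * of_nat q * complex_of_real x = of_nat k * of_real pi"
      by (metis of_real_mult of_real_numeral of_real_of_nat_eq)
    then show ?thesis by algebra
  qed
  also have "exp \<dots> = exp (\<zeta> + of_real x * \<i>) * P \<zeta> * (-1) ^ k"
  proof -
    have "exp (- of_nat k * (of_real pi * \<i>)) = exp (- (of_real pi * \<i>)) ^ k"
      by (simp flip: exp_of_nat_mult)
    also have "exp (- (of_real pi * \<i>)) = -1"
      using exp_pi_i by (simp add: exp_minus)
    finally show ?thesis by (simp only: exp_add P_def)
  qed
  finally show ?thesis by (simp add: chart_def x_def mult_ac)
qed

lemma V_chart:
  assumes "s > 0"
  shows "V (- l1 * s) (chart s k \<zeta>) = \<i> * chart s k \<zeta> * h s k \<zeta>"
  using chart_nonzero[OF assms, of k \<zeta>]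
  unfolding V_def h_def E_def norm_chart_squared[OF assms] cnj_chart_power[OF assms]
  by (simp add: field_simps)

lemma V_chart_eq_0_iff: "s > 0 \<Longrightarrow> V (- l1 * s) (chart s k \<zeta>) = 0 \<longleftrightarrow> h s k \<zeta> = 0"
  using V_chart[of s k \<zeta>] chart_nonzero[of s k \<zeta>] by simp

lemma scale_eq_0_iff: "s > 0 \<Longrightarrow> scale s k w = 0 \<longleftrightarrow> w = 0"
  using q l1 \<alpha> by (auto simp: scale_def complex_eq_iff)

lemma linear_scale: "linear (scale s k)"
  by (rule linearI) (auto simp: scale_def complex_eq_iff add_divide_distrib)

text \<open>\<open>scale s k\<close> is diagonal, so it divides determinants by the product of its
  two denominators. The sign of this product is the source of the alternation between saddles and
  centers.\<close>

lemma rdet_scale: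
  assumes "s > 0"
  shows "rdet H = - 4 * real q * s ^ q * (l1 * \<alpha> * (-1) ^ k) * rdet (\<lambda>w. scale s k (H w))"
proof -
  define a b where "a = 2 * l1 * s" and "b = - 2 * real q * \<alpha> * (-1) ^ k * s ^ (q - 1)"
  have ab: "a \<noteq> 0" "b \<noteq> 0" using q l1 \<alpha> assms by (auto simp: a_def b_def)
  have "s ^ q = s * s ^ (q - 1)" using q by (simp add: power_eq_if)
  then have "- 4 * real q * s ^ q * (l1 * \<alpha> * (-1) ^ k) = a * b" by (simp add: a_def b_def)
  moreover have "rdet H = a * b * rdet (\<lambda>w. scale s k (H w))"
    unfolding rdet_def scale_def a_def[symmetric] b_def[symmetric] using ab by (simp add: field_simps)
  ultimately show ?thesis by simp
qed

section \<open>Derivatives in the chart and transfer of the determinant\<close>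

lemma chart_has_derivative:
  "(chart s k has_derivative (\<lambda>w. chart s k \<zeta> * w)) (at \<zeta>)"
  unfolding chart_def by (auto intro!: derivative_eq_intros simp: algebra_simps)

lemma h_has_derivative:
  assumes "s > 0"
  shows "(h s k has_derivative Dh s k \<zeta>) (at \<zeta>)"
proof -
  let ?z = "chart s k \<zeta>"
  have 1: "((\<lambda>\<zeta>. \<Phi> (s * exp (2 * Re \<zeta>))) has_derivative
      (\<lambda>w. \<Phi>' (s * exp (2 * Re \<zeta>)) * (s * exp (2 * Re \<zeta>) * (2 * Re w)))) (at \<zeta>)"
  proof -
    have "((\<lambda>\<zeta>. s * exp (2 * Re \<zeta>)) has_derivative
      (\<lambda>w. s * exp (2 * Re \<zeta>) * (2 * Re w))) (at \<zeta>)"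
      by (auto intro!: derivative_eq_intros)
    from DERIV_compose_FDERIV[OF \<Phi> this] show ?thesis by (simp add: mult.commute)
  qed
  have 2: "(P has_derivative (\<lambda>w. P \<zeta> * ((2 * of_nat q - 1) * cnj w - w))) (at \<zeta>)"
  proof -
    have "((\<lambda>\<zeta>. (2 * of_nat q - 1) * cnj \<zeta> - \<zeta>) has_derivative
        (\<lambda>w. (2 * of_nat q - 1) * cnj w - w)) (at \<zeta>)"
      by (auto intro!: derivative_eq_intros)
    from has_derivative_compose[OF this DERIV_exp[unfolded has_field_derivative_def]]
    show ?thesis by (simp add: P_def[abs_def])
  qed
  have "((\<lambda>\<zeta>. R (- l1 * s) (chart s k \<zeta>)) has_derivative (\<lambda>w. DR (- l1 * s) ?z (?z * w))) (at \<zeta>)"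
    using diff_chain_at[OF chart_has_derivative R] by (simp add: o_def)
  then have "(E s k has_derivative (\<lambda>w. - R (- l1 * s) ?z * (inverse (\<i> * ?z) * (\<i> * (?z * w)) * inverse (\<i> * ?z))
      + DR (- l1 * s) ?z (?z * w) / (\<i> * ?z))) (at \<zeta>)"
    unfolding E_def using chart_nonzero[OF assms]
    by (intro has_derivative_divide has_derivative_mult_right chart_has_derivative) auto
  moreover have "(\<lambda>w. - R (- l1 * s) ?z * (inverse (\<i> * ?z) * (\<i> * (?z * w)) * inverse (\<i> * ?z))
      + DR (- l1 * s) ?z (?z * w) / (\<i> * ?z)) = DE s k \<zeta>"
    using chart_nonzero[OF assms, of k \<zeta>] by (auto simp: DE_def E_def field_simps)
  ultimately have 3: "(E s k has_derivative DE s k \<zeta>) (at \<zeta>)" by simp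
  show ?thesis unfolding h_def[abs_def] Dh_def[abs_def] of_real_add
    by (rule derivative_eq_intros 1 2 3 has_derivative_of_real refl | simp)+
qed

lemma V_differentiable: "V \<mu> differentiable at z"
proof -
  have "(\<lambda>z. \<Phi> ((norm z)\<^sup>2)) differentiable at z"
  proof -
    have "((\<lambda>z::complex. z \<bullet> z) has_derivative (\<lambda>w. z \<bullet> w + w \<bullet> z)) (at z)"
      by (auto intro!: derivative_eq_intros)
    from DERIV_compose_FDERIV[OF \<Phi> this] show ?thesis
      by (auto simp: differentiable_def power2_norm_eq_inner)
  qed
  then obtain D where "((\<lambda>z. \<Phi> ((norm z)\<^sup>2)) has_derivative D) (at z)" by (auto simp: differentiable_def)
  then have "((\<lambda>z. of_real (\<Phi> ((norm z)\<^sup>2)) :: complex) has_derivative (\<lambda>w. of_real (D w))) (at z)"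
    by (rule has_derivative_of_real)
  then have "(\<lambda>z. of_real (\<Phi> ((norm z)\<^sup>2)) :: complex) differentiable at z" by (auto simp: differentiable_def)
  moreover have "R \<mu> differentiable at z" using R differentiable_def by blast
  moreover have "cnj differentiable at z" using bounded_linear_cnj bounded_linear_imp_differentiable by blast
  ultimately show ?thesis unfolding V_def[abs_def]
    by (intro differentiable_add differentiable_mult differentiable_power differentiable_const
        differentiable_ident)
qed

text \<open>In the derivative of \<open>\<i> * chart s k \<zeta> * h s k \<zeta>\<close> the term
  containing \<open>h\<close> vanishes at a zero. The Jacobian of the field is therefore
  \<open>Dh\<close> conjugated by complex multiplications, which preserves the determinant.\<close>

lemma rdet_V_at_zero:
  assumes "s > 0" and h0: "h s k \<zeta> = 0"
  shows "rdet (frechet_derivative (V (- l1 * s)) (at (chart s k \<zeta>))) = rdet (Dh s k \<zeta>)"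
proof -
  let ?z = "chart s k \<zeta>" let ?L = "frechet_derivative (V (- l1 * s)) (at ?z)"
  have "(V (- l1 * s) \<circ> chart s k has_derivative ?L \<circ> (\<lambda>w. ?z * w)) (at \<zeta>)"
    using chart_has_derivative frechet_derivative_works[THEN iffD1, OF V_differentiable]
    by (rule diff_chain_at)
  moreover have "V (- l1 * s) \<circ> chart s k = (\<lambda>\<zeta>. \<i> * chart s k \<zeta> * h s k \<zeta>)"
    using V_chart[OF assms(1)] by auto
  moreover have "((\<lambda>\<zeta>. \<i> * chart s k \<zeta> * h s k \<zeta>) has_derivative (\<lambda>w. \<i> * ?z * Dh s k \<zeta> w)) (at \<zeta>)"
    by (rule derivative_eq_intros chart_has_derivative h_has_derivative assms(1) refl | simp add: h0)+
  ultimately have *: "?L \<circ> (\<lambda>w. ?z * w) = (\<lambda>w. \<i> * ?z * Dh s k \<zeta> w)"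
    by (metis has_derivative_unique)
  have "?L w = \<i> * ?z * Dh s k \<zeta> (w / ?z)" for w
    using fun_cong[OF *, of "w / ?z"] chart_nonzero[OF assms(1), of k \<zeta>] by simp
  then have "?L = (\<lambda>w. \<i> * ?z * Dh s k \<zeta> (w / ?z))" by auto
  then show ?thesis
    using rdet_conjugate[OF has_derivative_linear[OF h_has_derivative[OF assms(1)]] chart_nonzero[OF assms(1)]]
    by simp
qed

text \<open>For \<open>norm \<zeta> \<le> 1 / 2\<close> the point \<open>z\<close> of the chart
  satisfies \<open>norm z \<le> 2 * sqrt s\<close>, hence
  \<open>norm z ^ (2 * q) \<le> 4 ^ q * s ^ q\<close>. Division by \<open>z\<close> removes the
  extra power from the bound on \<open>R\<close>, and for \<open>DR\<close> it cancels the factor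
  \<open>z\<close> in the direction.\<close>

lemma remainder_bounds:
  assumes s: "s > 0" "4 * s < \<delta>\<^sup>2" "\<bar>l1\<bar> * s < \<delta>" and \<zeta>: "norm \<zeta> \<le> 1 / 2"
  shows "norm (E s k \<zeta>) \<le> C * 4 ^ q * s ^ q"
    and "norm (DE s k \<zeta> w) \<le> 2 * C * 4 ^ q * s ^ q * norm w"
proof -
  let ?z = "chart s k \<zeta>"
  have "exp (Re \<zeta>) \<le> exp (1 / 2)" using \<zeta> complex_Re_le_cmod[of \<zeta>] by simp
  then have "exp (Re \<zeta>) \<le> 2" using exp_half_le2 by linarith
  then have n: "norm ?z \<le> 2 * sqrt s" unfolding norm_chart[OF s(1)] using s by simp
  have "(2 * sqrt s)\<^sup>2 < \<delta>\<^sup>2" using s by (simp add: power_mult_distrib)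
  then have "2 * sqrt s < \<delta>" using \<delta> by (intro power2_less_imp_less[of _ \<delta>]) auto
  with n have n\<delta>: "norm ?z < \<delta>" by simp
  have z: "norm ?z > 0" using chart_nonzero[OF s(1)] by simp
  have \<mu>: "\<bar>- l1 * s\<bar> < \<delta>" using s by (simp add: abs_mult)
  have "norm ?z ^ (2 * q) \<le> (2 * sqrt s) ^ (2 * q)" using n by (intro power_mono) auto
  also have "\<dots> = 4 ^ q * s ^ q" using s by (simp add: power_mult power_mult_distrib)
  finally have pow: "C * norm ?z ^ (2 * q) \<le> C * 4 ^ q * s ^ q"
    using C by (simp add: mult_left_mono mult.assoc)
  have "norm (E s k \<zeta>) = norm (R (- l1 * s) ?z) / norm ?z"
    by (simp add: E_def norm_divide norm_mult)
  also have "\<dots> \<le> C * norm ?z ^ (2 * q + 1) / norm ?z"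
    using R_bound[OF \<mu> n\<delta>] by (rule divide_right_mono) simp
  also have "\<dots> = C * norm ?z ^ (2 * q)" using z by simp
  finally show E: "norm (E s k \<zeta>) \<le> C * 4 ^ q * s ^ q" using pow by simp
  have "norm (DR (- l1 * s) ?z (?z * w) / (\<i> * ?z)) = norm (DR (- l1 * s) ?z (?z * w)) / norm ?z"
    by (simp add: norm_divide norm_mult)
  also have "\<dots> \<le> C * norm ?z ^ (2 * q) * norm (?z * w) / norm ?z"
    using DR_bound[OF \<mu> n\<delta>] z by (intro divide_right_mono) auto
  also have "\<dots> = C * norm ?z ^ (2 * q) * norm w" using z by (simp add: norm_mult)
  also have "\<dots> \<le> C * 4 ^ q * s ^ q * norm w" using pow by (rule mult_right_mono) simp
  finally have DR: "norm (DR (- l1 * s) ?z (?z * w) / (\<i> * ?z)) \<le> C * 4 ^ q * s ^ q * norm w" .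
  have "norm (E s k \<zeta> * w) \<le> C * 4 ^ q * s ^ q * norm w"
    unfolding norm_mult using E by (rule mult_right_mono) simp
  with DR norm_triangle_ineq4[of "DR (- l1 * s) ?z (?z * w) / (\<i> * ?z)" "E s k \<zeta> * w"]
  show "norm (DE s k \<zeta> w) \<le> 2 * C * 4 ^ q * s ^ q * norm w" unfolding DE_def by linarith
qed

section \<open>Comparison of the scaled equation with the identity\<close>

lemma power_q: "s ^ q = s * s ^ (q - 1)" for s :: real
  using q by (simp add: power_eq_if)

lemma power_q1_le: "0 \<le> s \<Longrightarrow> s \<le> 1 \<Longrightarrow> s ^ (q - 1) \<le> s * s" for s :: real
  using q power_decreasing[of 2 "q - 1" s] by (simp add: power2_eq_square)

lemma power_q_le: "0 \<le> s \<Longrightarrow> s \<le> 1 \<Longrightarrow> s ^ q \<le> s * s" for s :: real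
  using q power_decreasing[of 2 q s] by (simp add: power2_eq_square)

text \<open>To leading order the real part of \<open>Dh\<close> is \<open>2 * l1 * s * Re w\<close>,
  from \<Phi>, since the resonant term is \<open>O(s ^ (q - 1))\<close> with
  \<open>q - 1 \<ge> 2\<close>. The imaginary part comes from the resonant term, as the \<Phi> term
  is real and \<open>DE\<close> is \<open>O(s ^ q)\<close>; its leading coefficient is
  \<open>- 2 * q\<close>, because \<open>(2 * q - 1) * cnj w - w\<close> has imaginary part
  \<open>- 2 * q * Im w\<close>.\<close>

lemma scale_Dh_near_id:
  "\<exists>\<eta>>0. \<exists>s0>0. \<forall>s k \<zeta> w. 0 < s \<and> s < s0 \<and> norm \<zeta> \<le> \<eta> \<longrightarrow>
     norm (w - scale s k (Dh s k \<zeta> w)) \<le> norm w / 4"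
proof -
  \<comment> \<open>Each component may err by \<open>norm w / 8\<close>: one 1/16 for the continuity
    errors, one for the terms carrying a factor \<open>s\<close>. In the real part the first splits
    as 1/32 + 2 * (1/64).\<close>
  have "isCont P 0" unfolding P_def[abs_def] by (intro continuous_intros)
  from isCont_norm_bound[OF this, of "1 / 16"]
  obtain d1 where d1: "d1 > 0" "\<And>\<zeta>. norm \<zeta> < d1 \<Longrightarrow> norm (P \<zeta> - 1) \<le> 1 / 16"
    by (auto simp: P_def)
  have "isCont (\<lambda>\<zeta>. exp (2 * Re \<zeta>)) 0"
    by (intro continuous_intros linear_continuous_at[OF bounded_linear_Re])
  from isCont_norm_bound[OF this, of "1 / 32"]
  obtain d2 where d2: "d2 > 0" "\<And>\<zeta>. norm \<zeta> < d2 \<Longrightarrow> \<bar>exp (2 * Re \<zeta>) - 1\<bar> \<le> 1 / 32"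
    by auto
  from isCont_norm_bound[OF \<Phi>'_cont, of "\<bar>l1\<bar> / 64"] l1
  obtain d3 where d3: "d3 > 0" "\<And>x. \<bar>x\<bar> < d3 \<Longrightarrow> \<bar>\<Phi>' x - l1\<bar> \<le> \<bar>l1\<bar> / 64"
    by (auto simp: \<Phi>'_0)
  \<comment> \<open>\<open>M\<close> collects the coefficients of \<open>s\<close> in the error
    terms of both components; the last bound in \<open>s0\<close> gives
    \<open>s * M \<le> 1 / 16\<close>.\<close>
  define M where "M = 2 * real q * \<bar>\<alpha>\<bar> / \<bar>l1\<bar> + C * 4 ^ q / \<bar>l1\<bar> + C * 4 ^ q / (real q * \<bar>\<alpha>\<bar>)"
  have M: "M \<ge> 0" using C by (simp add: M_def)
  define \<eta> where "\<eta> = min (1 / 2) (min (d1 / 2) (d2 / 2))"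
  define s0 where "s0 = min 1 (min (\<delta>\<^sup>2 / 4) (min (\<delta> / \<bar>l1\<bar>) (min (d3 / 2) (1 / (16 * (M + 1))))))"
  have "norm (w - scale s k (Dh s k \<zeta> w)) \<le> norm w / 4"
    if s: "0 < s" "s < s0" and \<zeta>: "norm \<zeta> \<le> \<eta>" for s k \<zeta> w
  proof -
    have s': "s \<le> 1" "4 * s < \<delta>\<^sup>2" "\<bar>l1\<bar> * s < \<delta>" "2 * s < d3"
      using s l1 by (auto simp: s0_def field_simps)
    have \<zeta>': "norm \<zeta> \<le> 1 / 2" "norm \<zeta> < d1" "norm \<zeta> < d2" using \<zeta> d1(1) d2(1) by (auto simp: \<eta>_def)
    have "s < 1 / (16 * (M + 1))" using s by (simp add: s0_def)
    then have sM: "s * M \<le> 1 / 16" using s M by (simp add: field_simps)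
    define e where "e = exp (2 * Re \<zeta>)"
    define X where "X = P \<zeta> * ((2 * of_nat q - 1) * cnj w - w)"
    define c where "c = \<alpha> * (-1) ^ k * s ^ (q - 1)"
    have Dh: "Dh s k \<zeta> w = of_real (\<Phi>' (s * e) * (s * e * (2 * Re w))) + of_real c * X + DE s k \<zeta> w"
      by (simp only: Dh_def e_def c_def X_def)
    have "\<bar>e - 1\<bar> \<le> 1 / 32" using d2(2) \<zeta>' by (simp add: e_def)
    then have e: "\<bar>1 - e\<bar> \<le> 1 / 32" "\<bar>e\<bar> \<le> 2" by linarith+
    have P1: "norm (P \<zeta> - 1) \<le> 1 / 16" using d1(2) \<zeta>' by simp
    have DE: "norm (DE s k \<zeta> w) \<le> 2 * C * 4 ^ q * s ^ q * norm w"
      using remainder_bounds(2) s s' \<zeta>' by blast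
    have Y: "norm ((2 * of_nat q - 1) * cnj w - w) \<le> 2 * real q * norm w"
    proof -
      have "norm ((2 * of_nat q - 1) * cnj w - w) \<le> norm (of_nat (2 * q - 1) * cnj w) + norm w"
        using q norm_triangle_ineq4 by (simp add: of_nat_diff)
      also have "\<dots> = 2 * real q * norm w"
        using q unfolding norm_mult norm_of_nat by (simp add: of_nat_diff algebra_simps)
      finally show ?thesis .
    qed
    have X: "norm X \<le> 4 * real q * norm w"
    proof -
      have "norm (P \<zeta>) \<le> 2" using P1 norm_triangle_ineq2[of "P \<zeta>" 1] by simp
      then have "norm X \<le> 2 * (2 * real q * norm w)"
        unfolding X_def norm_mult using Y by (intro mult_mono) auto
      then show ?thesis by simp
    qed
    have den: "\<bar>2 * l1 * s\<bar> = 2 * \<bar>l1\<bar> * s" using s by (simp add: abs_mult)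
    have re: "\<bar>Re w - Re (Dh s k \<zeta> w) / (2 * l1 * s)\<bar> \<le> norm w / 8"
    proof -
      have "Re w - Re (Dh s k \<zeta> w) / (2 * l1 * s)
          = Re w * (1 - e * \<Phi>' (s * e) / l1) - (c * Re X / (2 * l1 * s) + Re (DE s k \<zeta> w) / (2 * l1 * s))"
        using s l1 by (simp add: Dh field_simps)
      also have "\<bar>\<dots>\<bar> \<le> \<bar>Re w * (1 - e * \<Phi>' (s * e) / l1)\<bar>
          + (\<bar>c * Re X / (2 * l1 * s)\<bar> + \<bar>Re (DE s k \<zeta> w) / (2 * l1 * s)\<bar>)"
        by (intro order_trans[OF abs_triangle_ineq4] add_mono order_refl abs_triangle_ineq)
      also have "\<bar>Re w * (1 - e * \<Phi>' (s * e) / l1)\<bar> \<le> norm w * (1 / 16)"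
        unfolding abs_mult
      proof (intro mult_mono abs_Re_le_cmod)
        have "\<bar>s * e\<bar> < d3"
        proof -
          have "s * e \<le> s * 2" using e s by (intro mult_left_mono) auto
          moreover have "0 \<le> s * e" using s by (simp add: e_def)
          ultimately show ?thesis using s' by linarith
        qed
        then have "\<bar>\<Phi>' (s * e) - l1\<bar> / \<bar>l1\<bar> \<le> (\<bar>l1\<bar> / 64) / \<bar>l1\<bar>"
          by (intro divide_right_mono d3(2)) auto
        then have *: "\<bar>1 - \<Phi>' (s * e) / l1\<bar> \<le> 1 / 64"
          using l1 by (simp add: diff_divide_distrib abs_minus_commute flip: abs_divide)
        have "1 - e * \<Phi>' (s * e) / l1 = (1 - e) + e * (1 - \<Phi>' (s * e) / l1)" by (simp add: algebra_simps)
        also have "\<bar>\<dots>\<bar> \<le> \<bar>1 - e\<bar> + \<bar>e\<bar> * \<bar>1 - \<Phi>' (s * e) / l1\<bar>"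
          using abs_triangle_ineq[of "1 - e" "e * (1 - \<Phi>' (s * e) / l1)"] by (simp add: abs_mult)
        also have "\<dots> \<le> 1 / 32 + 2 * (1 / 64)"
          using e * by (intro add_mono mult_mono) auto
        finally show "\<bar>1 - e * \<Phi>' (s * e) / l1\<bar> \<le> 1 / 16" by simp
      qed auto
      also have "\<bar>c * Re X / (2 * l1 * s)\<bar> \<le> (\<bar>\<alpha>\<bar> * (s * s)) * (4 * real q * norm w) / (2 * \<bar>l1\<bar> * s)"
      proof -
        have "\<bar>c\<bar> \<le> \<bar>\<alpha>\<bar> * (s * s)"
          using power_q1_le[of s] s s' by (simp add: c_def abs_mult power_abs mult_left_mono)
        then have "\<bar>c * Re X\<bar> \<le> (\<bar>\<alpha>\<bar> * (s * s)) * (4 * real q * norm w)"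
          unfolding abs_mult using abs_Re_le_cmod[of X] X by (intro mult_mono) auto
        then show ?thesis unfolding abs_divide den by (rule divide_right_mono) (use s in simp)
      qed
      also have "\<bar>Re (DE s k \<zeta> w) / (2 * l1 * s)\<bar> \<le> (2 * C * 4 ^ q * (s * s) * norm w) / (2 * \<bar>l1\<bar> * s)"
      proof -
        have "\<bar>Re (DE s k \<zeta> w)\<bar> \<le> 2 * C * 4 ^ q * s ^ q * norm w"
          using abs_Re_le_cmod[of "DE s k \<zeta> w"] DE by linarith
        also have "\<dots> \<le> 2 * C * 4 ^ q * (s * s) * norm w"
          using power_q_le[of s] s s' C by (intro mult_right_mono mult_left_mono) auto
        finally show ?thesis unfolding abs_divide den by (rule divide_right_mono) (use s in simp)
      qed
      also have "norm w * (1 / 16) + ((\<bar>\<alpha>\<bar> * (s * s)) * (4 * real q * norm w) / (2 * \<bar>l1\<bar> * s)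
            + (2 * C * 4 ^ q * (s * s) * norm w) / (2 * \<bar>l1\<bar> * s))
          = norm w * (1 / 16 + s * (2 * real q * \<bar>\<alpha>\<bar> / \<bar>l1\<bar> + C * 4 ^ q / \<bar>l1\<bar>))"
        using s l1 by (simp add: field_simps)
      also have "\<dots> \<le> norm w * (1 / 16 + s * M)"
        using s C by (intro mult_left_mono add_mono) (auto simp: M_def)
      also have "\<dots> \<le> norm w * (1 / 8)" using sM by (intro mult_left_mono) auto
      finally show ?thesis by simp
    qed
    have im: "\<bar>Im w - Im (Dh s k \<zeta> w) / (- 2 * real q * c)\<bar> \<le> norm w / 8"
    proof -
      have c: "\<bar>c\<bar> = \<bar>\<alpha>\<bar> * s ^ (q - 1)" "c \<noteq> 0"
        using s \<alpha> by (auto simp: c_def abs_mult power_abs)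
      have "Im (Dh s k \<zeta> w) = c * Im X + Im (DE s k \<zeta> w)"
        by (simp add: Dh)
      then have "Im w - Im (Dh s k \<zeta> w) / (- 2 * real q * c)
          = (2 * real q * Im w + Im X) / (2 * real q) + Im (DE s k \<zeta> w) / (2 * real q * c)"
        using q c by (simp add: field_simps)
      \<comment> \<open>For \<open>P \<zeta> = 1\<close> the imaginary part of \<open>X\<close>
        would be exactly \<open>- 2 * real q * Im w\<close>; only \<open>P \<zeta> - 1\<close>
        survives.\<close>
      also have "2 * real q * Im w + Im X = Im ((P \<zeta> - 1) * ((2 * of_nat q - 1) * cnj w - w))"
        by (simp add: X_def algebra_simps)
      also have "\<bar>\<dots> / (2 * real q) + Im (DE s k \<zeta> w) / (2 * real q * c)\<bar>
          \<le> \<bar>\<dots> / (2 * real q)\<bar> + \<bar>Im (DE s k \<zeta> w) / (2 * real q * c)\<bar>"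
        by (rule abs_triangle_ineq)
      also have "\<bar>Im ((P \<zeta> - 1) * ((2 * of_nat q - 1) * cnj w - w)) / (2 * real q)\<bar> \<le> norm w * (1 / 16)"
      proof -
        have "\<bar>Im ((P \<zeta> - 1) * ((2 * of_nat q - 1) * cnj w - w))\<bar> \<le> (1 / 16) * (2 * real q * norm w)"
          using abs_Im_le_cmod[of "(P \<zeta> - 1) * ((2 * of_nat q - 1) * cnj w - w)"]
            mult_mono[OF P1 Y] by (simp add: norm_mult)
        then show ?thesis using q by (simp add: abs_divide field_simps)
      qed
      also have "\<bar>Im (DE s k \<zeta> w) / (2 * real q * c)\<bar>
          \<le> (2 * C * 4 ^ q * s ^ q * norm w) / (2 * real q * \<bar>c\<bar>)"
      proof -
        have "\<bar>2 * real q * c\<bar> = 2 * real q * \<bar>c\<bar>" by (simp add: abs_mult)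
        then show ?thesis
          using divide_right_mono[OF order_trans[OF abs_Im_le_cmod DE], of "2 * real q * \<bar>c\<bar>"]
          by (simp only: abs_divide)
      qed
      also have "\<dots> = norm w * (s * (C * 4 ^ q / (real q * \<bar>\<alpha>\<bar>)))"
        unfolding c power_q using s \<alpha> q by (simp add: field_simps)
      also have "\<dots> \<le> norm w * (s * M)"
        using s C by (intro mult_left_mono) (auto simp: M_def)
      also have "\<dots> \<le> norm w * (1 / 16)" using sM by (intro mult_left_mono) auto
      finally show ?thesis by simp
    qed
    have "scale s k (Dh s k \<zeta> w)
        = Complex (Re (Dh s k \<zeta> w) / (2 * l1 * s)) (Im (Dh s k \<zeta> w) / (- 2 * real q * c))"
      by (simp add: scale_def c_def mult.assoc)
    then have "norm (w - scale s k (Dh s k \<zeta> w)) \<le> norm w / 8 + norm w / 8"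
      using cmod_le[of "w - scale s k (Dh s k \<zeta> w)"] re im by simp
    then show ?thesis by simp
  qed
  moreover have "\<eta> > 0" "s0 > 0"
    using d1(1) d2(1) d3(1) \<delta> l1 M by (auto simp: \<eta>_def s0_def)
  ultimately show ?thesis by blast
qed

text \<open>At the approximate solution 0 the real part of \<open>h\<close> is \<open>O(s^2)\<close>
  and is divided by a multiple of \<open>s\<close>. As \<open>P 0 = 1\<close> is real, the imaginary
  part comes from \<open>E\<close> alone, and \<open>s ^ q\<close> is divided by a multiple of
  \<open>s ^ (q - 1)\<close>.\<close>

lemma scale_h_0_small: "\<exists>N\<ge>0. \<exists>s0>0. \<forall>s k. 0 < s \<and> s < s0 \<longrightarrow> norm (scale s k (h s k 0)) \<le> N * s"
proof -
  define C' where "C' = C * 4 ^ q"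
  have C': "C' \<ge> 0" using C by (simp add: C'_def)
  define N where "N = (K + \<bar>\<alpha>\<bar> + C') / (2 * \<bar>l1\<bar>) + C' / (2 * real q * \<bar>\<alpha>\<bar>)"
  define s0 where "s0 = min \<delta> (min (\<delta>\<^sup>2 / 4) (\<delta> / \<bar>l1\<bar>))"
  have "norm (scale s k (h s k 0)) \<le> N * s" if s: "0 < s" "s < s0" for s k
  proof -
    have s': "s \<le> 1" "4 * s < \<delta>\<^sup>2" "\<bar>l1\<bar> * s < \<delta>" "s < \<delta>"
      using s l1 \<delta> by (auto simp: s0_def field_simps)
    define c where "c = \<alpha> * (-1) ^ k * s ^ (q - 1)"
    have c: "\<bar>c\<bar> = \<bar>\<alpha>\<bar> * s ^ (q - 1)" "c \<noteq> 0"
      using s \<alpha> by (auto simp: c_def abs_mult power_abs)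
    have E: "norm (E s k 0) \<le> C' * s ^ q"
      unfolding C'_def using remainder_bounds(1)[of s 0] s s' by simp
    have h: "h s k 0 = of_real (\<Phi> s - l1 * s) + of_real c + E s k 0"
      by (simp add: h_def c_def P_def)
    have "\<bar>Re (h s k 0)\<bar> \<le> \<bar>\<Phi> s - l1 * s\<bar> + \<bar>c\<bar> + norm (E s k 0)"
      unfolding h using abs_Re_le_cmod[of "E s k 0"] by simp
    also have "\<dots> \<le> K * (s * s) + \<bar>\<alpha>\<bar> * (s * s) + C' * (s * s)"
    proof (intro add_mono)
      show "\<bar>\<Phi> s - l1 * s\<bar> \<le> K * (s * s)"
        using \<Phi>_bound[of s] s s' by (simp add: power2_eq_square)
      show "\<bar>c\<bar> \<le> \<bar>\<alpha>\<bar> * (s * s)"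
        unfolding c using power_q1_le[of s] s s' by (intro mult_left_mono) auto
      show "norm (E s k 0) \<le> C' * (s * s)"
        using E mult_left_mono[OF power_q_le[of s] C'] s s' by auto
    qed
    finally have "\<bar>Re (h s k 0)\<bar> \<le> (K + \<bar>\<alpha>\<bar> + C') * (s * s)" by (simp add: algebra_simps)
    then have "\<bar>Re (h s k 0)\<bar> / (2 * \<bar>l1\<bar> * s) \<le> (K + \<bar>\<alpha>\<bar> + C') * (s * s) / (2 * \<bar>l1\<bar> * s)"
      using s by (intro divide_right_mono) auto
    then have re: "\<bar>Re (h s k 0) / (2 * l1 * s)\<bar> \<le> (K + \<bar>\<alpha>\<bar> + C') / (2 * \<bar>l1\<bar>) * s"
      using s by (simp add: abs_divide abs_mult)
    have "\<bar>Im (h s k 0)\<bar> \<le> C' * s ^ q"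
      unfolding h using abs_Im_le_cmod[of "E s k 0"] E by simp
    then have "\<bar>Im (h s k 0)\<bar> / (2 * real q * \<bar>c\<bar>) \<le> C' * s ^ q / (2 * real q * \<bar>c\<bar>)"
      by (intro divide_right_mono) auto
    also have "\<dots> = C' / (2 * real q * \<bar>\<alpha>\<bar>) * s"
      unfolding c power_q using s \<alpha> q by (simp add: field_simps)
    finally have im: "\<bar>Im (h s k 0) / (- 2 * real q * c)\<bar> \<le> C' / (2 * real q * \<bar>\<alpha>\<bar>) * s"
      by (simp add: abs_divide abs_mult)
    have "scale s k (h s k 0) = Complex (Re (h s k 0) / (2 * l1 * s)) (Im (h s k 0) / (- 2 * real q * c))"
      by (simp add: scale_def c_def mult.assoc)
    then have "norm (scale s k (h s k 0))
        \<le> \<bar>Re (h s k 0) / (2 * l1 * s)\<bar> + \<bar>Im (h s k 0) / (- 2 * real q * c)\<bar>"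
      using cmod_le[of "scale s k (h s k 0)"] by simp
    also have "\<dots> \<le> N * s" using re im by (simp add: N_def algebra_simps)
    finally show ?thesis .
  qed
  moreover have "N \<ge> 0" "s0 > 0" using K C' \<delta> l1 by (auto simp: N_def s0_def)
  ultimately show ?thesis by blast
qed

text \<open>A simplified Newton iteration in which \<open>scale s k\<close> replaces the inverse
  derivative. The radius \<eta> is fixed before \<open>s\<close> and \<open>k\<close>, so one
  neighbourhood serves all parameters.\<close>

lemma unique_zero_in_chart:
  assumes "\<epsilon> > 0"
  obtains \<eta> N s0 where "0 < \<eta>" "\<eta> \<le> \<epsilon>" "N \<ge> 0" "s0 > 0"
    "\<And>s k. 0 < s \<Longrightarrow> s < s0 \<Longrightarrow> \<exists>!\<zeta>. norm \<zeta> \<le> \<eta> \<and> h s k \<zeta> = 0"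
    "\<And>s k \<zeta>. 0 < s \<Longrightarrow> s < s0 \<Longrightarrow> norm \<zeta> \<le> \<eta> \<Longrightarrow> h s k \<zeta> = 0 \<Longrightarrow>
       norm \<zeta> \<le> N * s \<and> l1 * \<alpha> * (-1) ^ k * rdet (Dh s k \<zeta>) < 0"
proof -
  obtain \<eta>1 s1 where \<eta>1: "\<eta>1 > 0" and s1: "s1 > 0"
    and near: "\<And>s k \<zeta> w. 0 < s \<Longrightarrow> s < s1 \<Longrightarrow> norm \<zeta> \<le> \<eta>1 \<Longrightarrow>
      norm (w - scale s k (Dh s k \<zeta> w)) \<le> norm w / 4"
    using scale_Dh_near_id by blast
  obtain N s2 where N: "N \<ge> 0" and s2: "s2 > 0"
    and small: "\<And>s k. 0 < s \<Longrightarrow> s < s2 \<Longrightarrow> norm (scale s k (h s k 0)) \<le> N * s"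
    using scale_h_0_small by blast
  define \<eta> where "\<eta> = min \<eta>1 \<epsilon>"
  have \<eta>: "0 < \<eta>" "\<eta> \<le> \<eta>1" "\<eta> \<le> \<epsilon>" using \<eta>1 assms by (auto simp: \<eta>_def)
  define s0 where "s0 = min (min s1 s2) (\<eta> / (2 * (N + 1)))"
  have main: "(\<exists>!\<zeta>. norm \<zeta> \<le> \<eta> \<and> h s k \<zeta> = 0) \<and>
    (\<forall>\<zeta>. norm \<zeta> \<le> \<eta> \<and> h s k \<zeta> = 0 \<longrightarrow> norm \<zeta> \<le> 2 * N * s \<and> l1 * \<alpha> * (-1) ^ k * rdet (Dh s k \<zeta>) < 0)"
    if s: "0 < s" "s < s0" for s k
  proof -
    have s': "s < s1" "s < s2" using s by (auto simp: s0_def)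
    have "s < \<eta> / (2 * (N + 1))" using s by (simp add: s0_def)
    \<comment> \<open>With contraction factor 1/4 this keeps the ball invariant: a quarter of \<eta>
      plus half of \<eta> is below \<eta>.\<close>
    then have Ns: "N * s \<le> \<eta> / 2" using s N by (simp add: field_simps)
    define T where "T \<zeta> = \<zeta> - scale s k (h s k \<zeta>)" for \<zeta>
    have T_fix: "T \<zeta> = \<zeta> \<longleftrightarrow> h s k \<zeta> = 0" for \<zeta>
      using scale_eq_0_iff[OF s(1), of k "h s k \<zeta>"] by (auto simp: T_def)
    have blin: "bounded_linear (scale s k)"
      using linear_scale linear_conv_bounded_linear by blast
    have contr: "norm (T x - T y) \<le> 1 / 4 * norm (x - y)" if "norm x \<le> \<eta>" "norm y \<le> \<eta>" for x y
    proof (rule differentiable_bound[of "cball 0 \<eta>" T "\<lambda>\<zeta> w. w - scale s k (Dh s k \<zeta> w)"])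
      fix \<zeta> :: complex assume "\<zeta> \<in> cball 0 \<eta>"
      then have \<zeta>: "norm \<zeta> \<le> \<eta>1" using \<eta> by simp
      show "(T has_derivative (\<lambda>w. w - scale s k (Dh s k \<zeta> w))) (at \<zeta> within cball 0 \<eta>)"
        unfolding T_def[abs_def]
        by (intro has_derivative_diff has_derivative_ident bounded_linear.has_derivative[OF blin]
            has_derivative_at_withinI[OF h_has_derivative] s)
      show "onorm (\<lambda>w. w - scale s k (Dh s k \<zeta> w)) \<le> 1 / 4"
        using near[OF s(1) s'(1) \<zeta>] by (intro onorm_le) simp
    qed (use that in auto)
    have T0: "norm (T 0) \<le> N * s" using small[OF s(1) s'(2), of k] by (simp add: T_def)
    have bd: "norm (T \<zeta>) \<le> 1 / 4 * norm \<zeta> + N * s" if "norm \<zeta> \<le> \<eta>" for \<zeta>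
      using contr[of \<zeta> 0] that \<eta> T0 norm_triangle_sub[of "T \<zeta>" "T 0"] by simp
    have "\<exists>!\<zeta>\<in>cball 0 \<eta>. T \<zeta> = \<zeta>"
    proof (rule Banach_fix[where c = "1 / 4"])
      show "complete (cball (0::complex) \<eta>)" by (simp add: complete_eq_closed)
      show "cball (0::complex) \<eta> \<noteq> {}" using \<eta> by auto
      show "T ` cball 0 \<eta> \<subseteq> cball 0 \<eta>"
      proof (intro image_subsetI)
        fix x :: complex assume "x \<in> cball 0 \<eta>"
        then show "T x \<in> cball 0 \<eta>" using bd[of x] Ns \<eta> by simp
      qed
    qed (use contr in \<open>auto simp: dist_norm\<close>)
    then have ex: "\<exists>!\<zeta>. norm \<zeta> \<le> \<eta> \<and> h s k \<zeta> = 0" by (simp add: T_fix)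
    moreover have "norm \<zeta> \<le> 2 * N * s \<and> l1 * \<alpha> * (-1) ^ k * rdet (Dh s k \<zeta>) < 0"
      if \<zeta>: "norm \<zeta> \<le> \<eta>" "h s k \<zeta> = 0" for \<zeta>
    proof
      \<comment> \<open>A fixed point thus has norm at most \<open>4 / 3 * N * s\<close>, rounded up
        to \<open>2 * N * s\<close>.\<close>
      have "norm \<zeta> \<le> 1 / 4 * norm \<zeta> + N * s" using bd[OF \<zeta>(1)] \<zeta>(2) T_fix[of \<zeta>] by simp
      moreover have "0 \<le> N * s" using N s by simp
      ultimately show "norm \<zeta> \<le> 2 * N * s" by linarith
      have pos: "rdet (\<lambda>w. scale s k (Dh s k \<zeta> w)) > 0"
        using near[OF s(1) s'(1)] \<zeta> \<eta> by (intro rdet_pos_of_near_id) auto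
      \<comment> \<open>Multiplying by the sign factor of \<open>rdet_scale\<close> turns it into a
        square, leaving a negative multiple of a positive determinant.\<close>
      have "l1 * \<alpha> * (-1) ^ k * rdet (Dh s k \<zeta>)
        = - (4 * real q * s ^ q * (l1 * \<alpha> * (-1) ^ k)\<^sup>2 * rdet (\<lambda>w. scale s k (Dh s k \<zeta> w)))"
        unfolding rdet_scale[OF s(1), of "Dh s k \<zeta>" k] by (simp add: power2_eq_square)
      moreover have "0 < 4 * real q * s ^ q * (l1 * \<alpha> * (-1) ^ k)\<^sup>2 * rdet (\<lambda>w. scale s k (Dh s k \<zeta> w))"
        using pos s q l1 \<alpha> by (intro mult_pos_pos) auto
      ultimately show "l1 * \<alpha> * (-1) ^ k * rdet (Dh s k \<zeta>) < 0" by simp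
    qed
    ultimately show ?thesis by blast
  qed
  have "0 < s0" using s1 s2 \<eta> N by (simp add: s0_def)
  moreover have "0 \<le> 2 * N" using N by simp
  ultimately show ?thesis
    using that[of \<eta> "2 * N" s0] \<eta> main by blast
qed

section \<open>The equilibrium at the origin\<close>

lemma V_0: "\<bar>\<mu>\<bar> < \<delta> \<Longrightarrow> V \<mu> 0 = 0"
  using R_bound[of \<mu> 0] q \<delta> by (simp add: V_def)

text \<open>All terms but the first are of order at least three, so a quadratic bound on their sum
  removes them.\<close>

lemma V_linearization:
  assumes \<mu>: "\<bar>\<mu>\<bar> < \<delta>"
  shows "(V \<mu> has_derivative (\<lambda>w. \<i> * of_real \<mu> * w)) (at 0)"
proof -
  have "((\<lambda>z. V \<mu> z - \<i> * of_real \<mu> * z) has_derivative (\<lambda>_. 0)) (at 0)"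
  proof (rule has_derivative_zero_of_quadratic[OF \<delta>(1)])
    fix z :: complex assume z: "norm z < \<delta>"
    let ?r = "norm z"
    have r: "?r \<le> 1" using z \<delta> by simp
    have r2: "?r\<^sup>2 \<le> 1 * ?r" unfolding power2_eq_square using r by (intro mult_right_mono) auto
    have pow: "?r ^ n \<le> ?r\<^sup>2" if "n \<ge> 2" for n using r that by (intro power_decreasing) auto
    have "\<bar>\<Phi> (?r\<^sup>2)\<bar> \<le> \<bar>l1\<bar> * ?r\<^sup>2 + K * ?r\<^sup>2"
    proof -
      have "\<bar>\<Phi> (?r\<^sup>2) - l1 * ?r\<^sup>2\<bar> \<le> K * (?r\<^sup>2)\<^sup>2" using r2 z by (intro \<Phi>_bound) auto
      also have "\<dots> \<le> K * ?r\<^sup>2"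
        using pow[of 4] K by (intro mult_left_mono) (auto simp flip: power_mult)
      finally have "\<bar>\<Phi> (?r\<^sup>2)\<bar> \<le> \<bar>l1 * ?r\<^sup>2\<bar> + K * ?r\<^sup>2" by linarith
      then show ?thesis by (simp add: abs_mult)
    qed
    then have 1: "\<bar>\<Phi> (?r\<^sup>2)\<bar> * ?r \<le> (\<bar>l1\<bar> * ?r\<^sup>2 + K * ?r\<^sup>2) * 1"
      using r K by (intro mult_mono) auto
    have 2: "\<bar>\<alpha>\<bar> * ?r ^ (2 * q - 1) \<le> \<bar>\<alpha>\<bar> * ?r\<^sup>2"
      using q by (intro mult_left_mono pow) auto
    have "C * ?r ^ (2 * q + 1) \<le> C * ?r\<^sup>2"
      using q C by (intro mult_left_mono pow) auto
    with R_bound[OF \<mu> z] have 3: "norm (R \<mu> z) \<le> C * ?r\<^sup>2" by linarith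
    have "norm (V \<mu> z - \<i> * of_real \<mu> * z)
        \<le> norm (\<i> * complex_of_real (\<Phi> (?r\<^sup>2)) * z) + norm (\<i> * complex_of_real \<alpha> * cnj z ^ (2 * q - 1)) + norm (R \<mu> z)"
    proof -
      have "V \<mu> z - \<i> * of_real \<mu> * z
          = \<i> * complex_of_real (\<Phi> (?r\<^sup>2)) * z + \<i> * complex_of_real \<alpha> * cnj z ^ (2 * q - 1) + R \<mu> z"
        by (simp add: V_def)
      then show ?thesis by (simp only:) (intro norm_triangle_le add_mono norm_triangle_ineq order_refl)
    qed
    also have "\<dots> = \<bar>\<Phi> (?r\<^sup>2)\<bar> * ?r + \<bar>\<alpha>\<bar> * ?r ^ (2 * q - 1) + norm (R \<mu> z)"
      by (simp add: norm_mult norm_power)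
    also have "\<dots> \<le> (\<bar>l1\<bar> + K + \<bar>\<alpha>\<bar> + C) * ?r\<^sup>2"
      using 1 2 3 by (simp add: algebra_simps)
    finally show "norm (V \<mu> z - \<i> * of_real \<mu> * z) \<le> (\<bar>l1\<bar> + K + \<bar>\<alpha>\<bar> + C) * ?r\<^sup>2" .
  qed
  moreover have "((\<lambda>z. \<i> * of_real \<mu> * z) has_derivative (\<lambda>w. \<i> * of_real \<mu> * w)) (at 0)"
    by (auto intro!: derivative_eq_intros)
  ultimately show ?thesis using has_derivative_add by fastforce
qed

lemma is_center_0:
  assumes "\<bar>\<mu>\<bar> < \<delta>" "\<mu> \<noteq> 0"
  shows "is_center (V \<mu>) 0"
proof -
  have F: "frechet_derivative (V \<mu>) (at 0) = (\<lambda>w. \<i> * of_real \<mu> * w)"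
    using V_linearization[OF assms(1)] frechet_derivative_at by metis
  show ?thesis
  proof (rule is_center_of_rdet_pos)
    show "divergence (V \<mu>) 0 = 0" by (simp add: divergence_def F)
    have "rdet (frechet_derivative (V \<mu>) (at 0)) = \<mu> * \<mu>" by (simp add: F rdet_def)
    then show "rdet (frechet_derivative (V \<mu>) (at 0)) > 0"
      using assms(2) by (metis not_square_less_zero linorder_neqE_linordered_idom mult_eq_0_iff)
  qed (use V_0 V_differentiable assms in auto)
qed

section \<open>Separation of the charts and location of the equilibria\<close>

lemma chart_inj:
  assumes s: "s > 0" and \<zeta>: "norm \<zeta> \<le> 1 / (4 * real q)" "norm \<zeta>' \<le> 1 / (4 * real q)"
    and kj: "k < 4 * q" "j < 4 * q" and eq: "chart s k \<zeta> = chart s j \<zeta>'"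
  shows "k = j"
proof -
  have "exp (\<zeta> + of_real (real k * pi / (2 * real q)) * \<i>) = exp (\<zeta>' + of_real (real j * pi / (2 * real q)) * \<i>)"
    using eq s by (simp add: chart_def)
  then obtain n :: int where "\<zeta> + of_real (real k * pi / (2 * real q)) * \<i>
      = \<zeta>' + of_real (real j * pi / (2 * real q)) * \<i> + of_real (of_int (2 * n) * pi) * \<i>"
    unfolding exp_eq by blast
  from arg_cong[OF this, of Im] have
    "Im \<zeta> + real k * pi / (2 * real q) = Im \<zeta>' + real j * pi / (2 * real q) + of_int (2 * n) * pi"
    by simp
  \<comment> \<open>Angles are measured in units of \<open>pi / (2 * q)\<close>, the spacing of the
    expected directions. The deviations amount to less than one unit, so the integer on the left is
    0.\<close>
  then have "(of_int (int k - int j - 4 * int q * n)) * (pi / (2 * real q)) = Im \<zeta>' - Im \<zeta>"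
    using q by (simp add: field_simps)
  moreover have "\<bar>Im \<zeta>' - Im \<zeta>\<bar> < pi / (2 * real q)"
  proof -
    have "\<bar>Im \<zeta>' - Im \<zeta>\<bar> \<le> 1 / (4 * real q) + 1 / (4 * real q)"
      using \<zeta> abs_Im_le_cmod[of \<zeta>] abs_Im_le_cmod[of \<zeta>'] by linarith
    also have "\<dots> < pi / (2 * real q)" using q pi_gt3 by (simp add: field_simps)
    finally show ?thesis .
  qed
  ultimately have "\<bar>of_int (int k - int j - 4 * int q * n)\<bar> * (pi / (2 * real q)) < 1 * (pi / (2 * real q))"
    using q by (simp add: abs_mult)
  then have "\<bar>of_int (int k - int j - 4 * int q * n)\<bar> < (1::real)"
    by (rule mult_right_less_imp_less) simp
  then have *: "int k - int j = 4 * int q * n" by linarith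
  have "n = 0"
  proof (rule ccontr)
    assume "n \<noteq> 0"
    then have "4 * int q * 1 \<le> 4 * int q * \<bar>n\<bar>" by (intro mult_left_mono) auto
    also have "\<dots> = \<bar>int k - int j\<bar>" using * by (simp add: abs_mult)
    finally show False using kj by linarith
  qed
  with * show ?thesis by simp
qed

text \<open>A priori localization in polar coordinates: the real part of the divided equation fixes
  the modulus, the imaginary part fixes the argument modulo \<open>pi / (2 * q)\<close>.\<close>

lemma zero_lies_in_chart:
  assumes "\<eta> > 0"
  shows "\<exists>\<rho>>0. \<forall>\<mu> z. \<bar>\<mu>\<bar> < \<delta> \<and> z \<noteq> 0 \<and> norm z < \<rho> \<and> V \<mu> z = 0 \<longrightarrow>
    \<mu> * l1 < 0 \<and> (\<exists>k<4 * q. \<exists>\<zeta>. norm \<zeta> \<le> \<eta> \<and> z = chart (- \<mu> / l1) k \<zeta>)"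
proof -
  have "isCont ln (1::real)" by (simp add: isCont_ln)
  from isCont_norm_bound[OF this, of "\<eta>"] assms
  obtain d1 where d1: "d1 > 0" "\<And>x. \<bar>x - 1\<bar> < d1 \<Longrightarrow> \<bar>ln x\<bar> \<le> \<eta>" by auto
  have "isCont arcsin 0" by (rule isCont_arcsin) auto
  from isCont_norm_bound[OF this, of "\<eta> / 2"] assms
  obtain d2 where d2: "d2 > 0" "\<And>x. \<bar>x\<bar> < d2 \<Longrightarrow> \<bar>arcsin x\<bar> \<le> \<eta> / 2" by auto
  \<comment> \<open>The value 1/2 yields \<open>r^2 \<le> 2 * s\<close>, hence \<open>s > 0\<close>;
    the value \<open>d1 / 3\<close> then gives a relative error of at most
    \<open>2 * c < d1\<close>, which the logarithm tolerates.\<close>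
  define c where "c = min (1 / 2) (d1 / 3)"
  define M where "M = K + \<bar>\<alpha>\<bar> + C"
  have c: "c > 0" using d1 by (simp add: c_def)
  have M: "M \<ge> 0" using K C by (simp add: M_def)
  \<comment> \<open>The first bound serves the modulus estimate, the second the estimate of the
    sine.\<close>
  define \<rho>2 where "\<rho>2 = min (c * \<bar>l1\<bar> / (M + 1)) (d2 * \<bar>\<alpha>\<bar> / (C + 1))"
  have \<rho>2: "\<rho>2 > 0" using c l1 \<alpha> d2 M C by (auto simp: \<rho>2_def)
  define \<rho> where "\<rho> = min \<delta> \<rho>2"
  have "\<mu> * l1 < 0 \<and> (\<exists>k<4 * q. \<exists>\<zeta>. norm \<zeta> \<le> \<eta> \<and> z = chart (- \<mu> / l1) k \<zeta>)"
    if \<mu>: "\<bar>\<mu>\<bar> < \<delta>" and z0: "z \<noteq> 0" and z: "norm z < \<rho>" and Vz: "V \<mu> z = 0" for \<mu> z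
  proof -
    define r where "r = norm z"
    define s where "s = - \<mu> / l1"
    define \<theta> where "\<theta> = Arg z"
    define t where "t = 2 * real q * \<theta>"
    define Q where "Q = cnj z ^ (2 * q - 1) / z"
    define W where "W = R \<mu> z / (\<i> * z)"
    have r: "r > 0" "r < \<delta>" "r \<le> 1" "r < \<rho>2" using z z0 \<delta> by (auto simp: r_def \<rho>_def)
    have z_polar: "z = of_real r * cis \<theta>"
      using rcis_cmod_Arg[of z] by (simp add: r_def \<theta>_def rcis_def)
    have rsq: "r\<^sup>2 \<le> 1 * r" "r\<^sup>2 > 0"
      unfolding power2_eq_square using r by (auto intro: mult_right_mono)
    have W: "norm W \<le> C * r ^ (2 * q)"
    proof -
      have "norm W = norm (R \<mu> z) / r" by (simp add: W_def norm_divide norm_mult r_def)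
      also have "\<dots> \<le> C * r ^ (2 * q + 1) / r"
        using R_bound[OF \<mu>, of z] r by (intro divide_right_mono) (auto simp: r_def)
      finally show ?thesis using r by simp
    qed
    have Q: "Q = of_real (r ^ (2 * q - 2)) * cis (- t)"
    proof -
      have "cnj z = of_real r * cis (- \<theta>)" by (simp add: z_polar cis_cnj)
      then have "cnj z ^ (2 * q - 1) = of_real (r ^ (2 * q - 1)) * cis (real (2 * q - 1) * - \<theta>)"
        by (simp only: power_mult_distrib Complex.DeMoivre of_real_power)
      also have "cis (real (2 * q - 1) * - \<theta>) = cis (- t) * cis \<theta>"
        using q by (simp add: cis_mult t_def of_nat_diff algebra_simps)
      also have "r ^ (2 * q - 1) = r ^ (2 * q - 2) * r"
        using q power_add[of r "2 * q - 2" 1] by (simp add: numeral_2_eq_2 Suc_diff_Suc)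
      finally have "cnj z ^ (2 * q - 1) = of_real (r ^ (2 * q - 2)) * cis (- t) * z"
        unfolding z_polar by (simp only: of_real_mult mult_ac)
      then show ?thesis using z0 by (simp add: Q_def)
    qed
    have eq: "of_real (\<mu> + \<Phi> (r\<^sup>2)) + of_real \<alpha> * Q + W = 0"
    proof -
      have "V \<mu> z = \<i> * z * (of_real (\<mu> + \<Phi> (r\<^sup>2)) + of_real \<alpha> * Q + W)"
        using z0 by (simp add: V_def Q_def W_def r_def field_simps)
      then show ?thesis using Vz z0 by simp
    qed
    \<comment> \<open>Real part of the equation: beside \<open>\<mu> + l1 * r^2\<close> every term
      is \<open>O(r ^ 4)\<close>, as \<open>2 * q - 2 \<ge> 4\<close>.\<close>
    have sr: "\<bar>r\<^sup>2 - s\<bar> \<le> c * r\<^sup>2"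
    proof -
      have pow: "r ^ n \<le> r ^ 4" if "n \<ge> 4" for n using r that by (intro power_decreasing) auto
      have "\<mu> + \<Phi> (r\<^sup>2) = - (\<alpha> * Re Q + Re W)" using arg_cong[OF eq, of Re] by simp
      then have "\<mu> + l1 * r\<^sup>2 = - (\<Phi> (r\<^sup>2) - l1 * r\<^sup>2) - \<alpha> * Re Q - Re W" by linarith
      also have "\<bar>\<dots>\<bar> \<le> \<bar>\<Phi> (r\<^sup>2) - l1 * r\<^sup>2\<bar> + \<bar>\<alpha> * Re Q\<bar> + \<bar>Re W\<bar>" by linarith
      also have "\<dots> \<le> K * r ^ 4 + \<bar>\<alpha>\<bar> * r ^ 4 + C * r ^ 4"
      proof (intro add_mono)
        have "\<bar>\<Phi> (r\<^sup>2) - l1 * r\<^sup>2\<bar> \<le> K * (r\<^sup>2)\<^sup>2" using rsq r by (intro \<Phi>_bound) auto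
        then show "\<bar>\<Phi> (r\<^sup>2) - l1 * r\<^sup>2\<bar> \<le> K * r ^ 4" by (simp flip: power_mult)
        have "\<bar>Re Q\<bar> \<le> r ^ (2 * q - 2)"
          using abs_Re_le_cmod[of Q] r by (simp add: Q norm_mult norm_power)
        also have "\<dots> \<le> r ^ 4" using q by (intro pow) auto
        finally show "\<bar>\<alpha> * Re Q\<bar> \<le> \<bar>\<alpha>\<bar> * r ^ 4" unfolding abs_mult by (rule mult_left_mono) simp
        have "C * r ^ (2 * q) \<le> C * r ^ 4" using q C by (intro mult_left_mono pow) auto
        then show "\<bar>Re W\<bar> \<le> C * r ^ 4" using W abs_Re_le_cmod[of W] by linarith
      qed
      also have "\<dots> = M * r\<^sup>2 * r\<^sup>2" by (simp add: M_def algebra_simps flip: power_add)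
      also have "\<dots> \<le> (c * \<bar>l1\<bar>) * r\<^sup>2"
      proof (rule mult_right_mono)
        have "r < c * \<bar>l1\<bar> / (M + 1)" using r by (simp add: \<rho>2_def)
        then have "r * (M + 1) < c * \<bar>l1\<bar>" using M by (simp add: field_simps)
        moreover have "M * r\<^sup>2 \<le> M * r" using M rsq by (intro mult_left_mono) auto
        ultimately show "M * r\<^sup>2 \<le> c * \<bar>l1\<bar>" using r by (simp add: algebra_simps)
      qed simp
      finally have "\<bar>\<mu> + l1 * r\<^sup>2\<bar> / \<bar>l1\<bar> \<le> c * \<bar>l1\<bar> * r\<^sup>2 / \<bar>l1\<bar>"
        by (rule divide_right_mono) simp
      moreover have "\<bar>\<mu> + l1 * r\<^sup>2\<bar> / \<bar>l1\<bar> = \<bar>r\<^sup>2 - s\<bar>"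
        using l1 by (simp add: s_def add_divide_distrib flip: abs_divide)
      ultimately show ?thesis using l1 by simp
    qed
    have "c * r\<^sup>2 \<le> 1 / 2 * r\<^sup>2" by (intro mult_right_mono) (auto simp: c_def)
    with sr have s_ge: "r\<^sup>2 \<le> 2 * s" by linarith
    then have s: "s > 0" using rsq by linarith
    have "s * l1\<^sup>2 = - (\<mu> * l1)" using l1 by (simp add: s_def power2_eq_square)
    moreover have "s * l1\<^sup>2 > 0" using s l1 by simp
    ultimately have \<mu>l1: "\<mu> * l1 < 0" by linarith
    define a where "a = ln (r\<^sup>2 / s) / 2"
    have "\<bar>a\<bar> \<le> \<eta> / 2"
    proof -
      have "r\<^sup>2 / s - 1 = (r\<^sup>2 - s) / s" using s by (simp add: field_simps)
      then have "\<bar>r\<^sup>2 / s - 1\<bar> = \<bar>r\<^sup>2 - s\<bar> / s" by (simp only: abs_divide abs_of_pos[OF s])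
      also have "\<bar>r\<^sup>2 - s\<bar> \<le> c * (2 * s)"
        using sr mult_left_mono[OF s_ge less_imp_le[OF c]] by linarith
      then have "\<bar>r\<^sup>2 - s\<bar> / s \<le> c * (2 * s) / s" using s by (intro divide_right_mono) auto
      also have "\<dots> < d1" using s d1 by (simp add: c_def)
      finally show ?thesis using d1(2) by (simp add: a_def)
    qed
    have exp_a: "sqrt s * exp a = r"
    proof (rule power2_eq_imp_eq)
      have "(exp a)\<^sup>2 = r\<^sup>2 / s"
        unfolding a_def exp_double[symmetric] using s rsq by simp
      then show "(sqrt s * exp a)\<^sup>2 = r\<^sup>2" using s by (simp add: power_mult_distrib)
    qed (use s r in auto)
    obtain j :: int and y where t: "t = of_int j * pi + y" and y: "\<bar>y\<bar> \<le> pi / 2"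
      and siny: "\<bar>sin t\<bar> = \<bar>sin y\<bar>" by (rule nearest_zero_of_sin)
    have "\<bar>sin y\<bar> < d2"
    proof -
      \<comment> \<open>Imaginary part of the equation: \<open>r ^ (2 * q - 2)\<close> times the
        sine must balance a remainder of order \<open>r ^ (2 * q)\<close>, so the sine is
        \<open>O(r^2)\<close>.\<close>
      have "\<alpha> * Im Q = - Im W" using arg_cong[OF eq, of Im] by simp
      then have "\<bar>\<alpha>\<bar> * \<bar>Im Q\<bar> \<le> C * r ^ (2 * q)"
        using W abs_Im_le_cmod[of W] by (metis abs_minus_cancel abs_mult order_trans)
      moreover have "\<bar>Im Q\<bar> = r ^ (2 * q - 2) * \<bar>sin y\<bar>"
        using r by (simp add: Q abs_mult siny power_abs)
      moreover have "r ^ (2 * q) = r ^ (2 * q - 2) * r\<^sup>2"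
      proof -
        have "2 * q = (2 * q - 2) + 2" using q by simp
        then show ?thesis by (metis power_add)
      qed
      ultimately have "r ^ (2 * q - 2) * (\<bar>\<alpha>\<bar> * \<bar>sin y\<bar>) \<le> r ^ (2 * q - 2) * (C * r\<^sup>2)"
        by (simp add: mult_ac)
      then have "\<bar>\<alpha>\<bar> * \<bar>sin y\<bar> \<le> C * r\<^sup>2" using r by simp
      also have "\<dots> \<le> C * r" using rsq C by (intro mult_left_mono) auto
      also have "\<dots> < d2 * \<bar>\<alpha>\<bar>"
      proof -
        have "r < d2 * \<bar>\<alpha>\<bar> / (C + 1)" using r by (simp add: \<rho>2_def)
        then have "r * (C + 1) < d2 * \<bar>\<alpha>\<bar>" using C by (simp add: field_simps)
        then show ?thesis using r by (simp add: algebra_simps)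
      qed
      finally have "\<bar>\<alpha>\<bar> * \<bar>sin y\<bar> < \<bar>\<alpha>\<bar> * d2" by (simp add: mult.commute)
      then show ?thesis by (rule mult_left_less_imp_less) simp
    qed
    then have "\<bar>arcsin (sin y)\<bar> \<le> \<eta> / 2" by (rule d2(2))
    then have "\<bar>y\<bar> \<le> \<eta> / 2" using y arcsin_sin[of y] by auto
    moreover have "\<bar>y / (2 * real q)\<bar> \<le> \<bar>y\<bar> / 1"
      unfolding abs_divide using q by (intro frac_le) auto
    ultimately have b: "\<bar>y / (2 * real q)\<bar> \<le> \<eta> / 2" by simp
    \<comment> \<open>Half the logarithm of \<open>r^2 / s\<close> corrects the modulus, the
      remaining angle the direction. A full turn of the argument shifts \<open>j\<close> by
      \<open>4 * q\<close>, so \<open>k\<close> is its residue.\<close>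
    define \<zeta> where "\<zeta> = Complex a (y / (2 * real q))"
    define k where "k = nat (j mod (4 * int q))"
    define m where "m = j div (4 * int q)"
    have jm: "0 \<le> j mod (4 * int q)" "j mod (4 * int q) < 4 * int q" using q by auto
    then have k: "k < 4 * q" by (simp add: k_def nat_less_iff)
    have "j = 4 * int q * m + int k" using jm by (simp add: m_def k_def)
    from arg_cong[OF this, of real_of_int] have "of_int j = 4 * real q * of_int m + real k" by simp
    then have "2 * real q * \<theta> = (4 * real q * of_int m + real k) * pi + y"
      using t by (simp add: t_def)
    then have "\<theta> = 2 * pi * of_int m + (y / (2 * real q) + real k * pi / (2 * real q))"
      using q by (simp add: field_simps)
    then have "cis \<theta> = cis (2 * pi * of_int m) * cis (y / (2 * real q) + real k * pi / (2 * real q))"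
      by (simp only: cis_mult)
    also have "cis (2 * pi * of_int m) = 1" by (rule cis_multiple_2pi) simp
    finally have cis: "cis \<theta> = cis (y / (2 * real q) + real k * pi / (2 * real q))" by simp
    have "chart s k \<zeta> = of_real (sqrt s * exp a) * cis (y / (2 * real q) + real k * pi / (2 * real q))"
      by (simp add: chart_def \<zeta>_def exp_eq_polar)
    then have "z = chart s k \<zeta>" using exp_a cis z_polar by simp
    moreover have "norm \<zeta> \<le> \<eta>"
      using cmod_le[of \<zeta>] \<open>\<bar>a\<bar> \<le> \<eta> / 2\<close> b by (simp add: \<zeta>_def)
    ultimately show ?thesis using k \<mu>l1 by (auto simp: s_def)
  qed
  moreover have "\<rho> > 0" using \<delta> \<rho>2 by (simp add: \<rho>_def)
  ultimately show ?thesis by blast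
qed

section \<open>Assembly of the ring of equilibria\<close>

lemma garland:
  assumes div_free: "\<And>\<mu> z. divergence (V \<mu>) z = 0"
  shows "\<exists>U \<mu>0 (Z :: real \<Rightarrow> nat \<Rightarrow> complex). open U \<and> 0 \<in> U \<and> \<mu>0 > 0 \<and>
     (\<forall>\<mu>. \<mu> \<noteq> 0 \<and> \<bar>\<mu>\<bar> < \<mu>0 \<and> \<mu> * l1 > 0 \<longrightarrow>
          {z \<in> U. V \<mu> z = 0} = {0} \<and> is_center (V \<mu>) 0) \<and>
     (\<forall>\<mu>. \<mu> \<noteq> 0 \<and> \<bar>\<mu>\<bar> < \<mu>0 \<and> \<mu> * l1 < 0 \<longrightarrow>
          is_center (V \<mu>) 0 \<and>
          {z \<in> U. V \<mu> z = 0} = insert 0 (Z \<mu> ` {..<4 * q}) \<and>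
          inj_on (Z \<mu>) {..<4 * q} \<and> 0 \<notin> Z \<mu> ` {..<4 * q} \<and>
          (\<forall>k < 4 * q. nondegenerate_equilibrium (V \<mu>) (Z \<mu> k) \<and>
             (if (even k \<longleftrightarrow> \<alpha> * l1 > 0) then is_saddle (V \<mu>) (Z \<mu> k)
              else is_center (V \<mu>) (Z \<mu> k)))) \<and>
     (\<forall>k < 4 * q.
        (\<lambda>\<mu>. (norm (Z \<mu> k))\<^sup>2 - (- \<mu> / l1)) \<in> O[at 0 within {\<mu>. \<mu> * l1 < 0}](\<lambda>\<mu>. \<mu> ^ 2) \<and>
        ((\<lambda>\<mu>. Z \<mu> k / complex_of_real (norm (Z \<mu> k))) \<longlongrightarrow> cis (real k * pi / (2 * real q)))
          (at 0 within {\<mu>. \<mu> * l1 < 0}))"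
proof (rule unique_zero_in_chart)
  \<comment> \<open>The upper limit for \<eta> is the one required by \<open>chart_inj\<close>, so
    different charts give different equilibria.\<close>
  show "1 / (4 * real q) > 0" using q by simp
next
  fix \<eta> N s0
  assume \<eta>: "0 < \<eta>" "\<eta> \<le> 1 / (4 * real q)" and N: "N \<ge> 0" and s0: "s0 > 0"
    and ex1: "\<And>s k. 0 < s \<Longrightarrow> s < s0 \<Longrightarrow> \<exists>!\<zeta>. norm \<zeta> \<le> \<eta> \<and> h s k \<zeta> = 0"
    and zero: "\<And>s k \<zeta>. 0 < s \<Longrightarrow> s < s0 \<Longrightarrow> norm \<zeta> \<le> \<eta> \<Longrightarrow> h s k \<zeta> = 0 \<Longrightarrow>
      norm \<zeta> \<le> N * s \<and> l1 * \<alpha> * (-1) ^ k * rdet (Dh s k \<zeta>) < 0"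
  have "1 / (4 * real q) \<le> 1 / (4 * 1)" using q by (intro divide_left_mono) auto
  then have \<eta>4: "\<eta> \<le> 1 / 4" using \<eta> by simp
  obtain \<rho> where \<rho>: "\<rho> > 0" and locate: "\<And>\<mu> z. \<bar>\<mu>\<bar> < \<delta> \<Longrightarrow> z \<noteq> 0 \<Longrightarrow> norm z < \<rho> \<Longrightarrow> V \<mu> z = 0 \<Longrightarrow>
    \<mu> * l1 < 0 \<and> (\<exists>k<4 * q. \<exists>\<zeta>. norm \<zeta> \<le> \<eta> \<and> z = chart (- \<mu> / l1) k \<zeta>)"
    using zero_lies_in_chart[OF \<eta>(1)] by blast
  \<comment> \<open>With \<open>s = - \<mu> / l1\<close> this keeps \<open>s\<close> below
    \<open>s0\<close> and \<open>4 * s\<close> below the square of \<rho>; the zeros satisfy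
    \<open>norm z ^ 2 \<le> 2 * s\<close> and so lie in the ball of radius \<rho>.\<close>
  define \<mu>0 where "\<mu>0 = min \<delta> (\<bar>l1\<bar> * min s0 (\<rho>\<^sup>2 / 4))"
  \<comment> \<open>The description is unique for \<open>\<mu> * l1 < 0\<close> and
    \<open>\<bar>\<mu>\<bar> < \<mu>0\<close>; all claims on \<open>Z\<close> are confined to such
    \<mu> or to limits from that side.\<close>
  define zt where "zt \<mu> k = (THE \<zeta>. norm \<zeta> \<le> \<eta> \<and> h (- \<mu> / l1) k \<zeta> = 0)" for \<mu> k
  define Z where "Z \<mu> k = chart (- \<mu> / l1) k (zt \<mu> k)" for \<mu> k
  have \<mu>0: "\<mu>0 > 0" using \<delta> s0 l1 \<rho> by (simp add: \<mu>0_def)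
  have s: "0 < - \<mu> / l1" "- \<mu> / l1 < s0" "4 * (- \<mu> / l1) < \<rho>\<^sup>2" "- l1 * (- \<mu> / l1) = \<mu>"
    if \<mu>: "\<bar>\<mu>\<bar> < \<mu>0" "\<mu> * l1 < 0" for \<mu>
  proof -
    have abs: "- \<mu> / l1 = \<bar>\<mu>\<bar> / \<bar>l1\<bar>" using \<mu> by (auto simp: mult_less_0_iff)
    have "\<bar>l1\<bar> > 0" using l1 by simp
    moreover have "\<bar>\<mu>\<bar> < \<bar>l1\<bar> * min s0 (\<rho>\<^sup>2 / 4)" using \<mu>(1) by (simp add: \<mu>0_def)
    ultimately have "\<bar>\<mu>\<bar> / \<bar>l1\<bar> < min s0 (\<rho>\<^sup>2 / 4)"
      by (simp only: pos_divide_less_eq mult.commute)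
    then show "- \<mu> / l1 < s0" "4 * (- \<mu> / l1) < \<rho>\<^sup>2" unfolding abs by linarith+
    have "\<mu> \<noteq> 0" using \<mu> by auto
    then show "0 < - \<mu> / l1" unfolding abs using l1 by simp
    show "- l1 * (- \<mu> / l1) = \<mu>" using l1 by simp
  qed
  have zt: "norm (zt \<mu> k) \<le> \<eta>" "h (- \<mu> / l1) k (zt \<mu> k) = 0"
    and zt_eq: "\<And>\<zeta>. norm \<zeta> \<le> \<eta> \<Longrightarrow> h (- \<mu> / l1) k \<zeta> = 0 \<Longrightarrow> \<zeta> = zt \<mu> k"
    if \<mu>: "\<bar>\<mu>\<bar> < \<mu>0" "\<mu> * l1 < 0" for \<mu> k
  proof -
    note ex1' = ex1[OF s(1,2)[OF \<mu>], of k]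
    show "norm (zt \<mu> k) \<le> \<eta>" unfolding zt_def by (rule conjunct1[OF theI'[OF ex1']])
    show "h (- \<mu> / l1) k (zt \<mu> k) = 0" unfolding zt_def by (rule conjunct2[OF theI'[OF ex1']])
    show "\<zeta> = zt \<mu> k" if "norm \<zeta> \<le> \<eta>" "h (- \<mu> / l1) k \<zeta> = 0" for \<zeta>
      unfolding zt_def by (rule the1_equality[OF ex1' conjI[OF that], symmetric])
  qed
  have V0: "V \<mu> 0 = 0" and center0: "\<mu> \<noteq> 0 \<Longrightarrow> is_center (V \<mu>) 0" if "\<bar>\<mu>\<bar> < \<mu>0" for \<mu>
    using V_0 is_center_0 that by (auto simp: \<mu>0_def)
  have VZ: "V \<mu> (Z \<mu> k) = 0" "Z \<mu> k \<noteq> 0" "norm (Z \<mu> k) < \<rho>" if \<mu>: "\<bar>\<mu>\<bar> < \<mu>0" "\<mu> * l1 < 0" for \<mu> k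
  proof -
    show "V \<mu> (Z \<mu> k) = 0"
      using V_chart_eq_0_iff[OF s(1)[OF \<mu>], of k "zt \<mu> k"] zt(2)[OF \<mu>] s(4)[OF \<mu>] by (simp add: Z_def)
    show "Z \<mu> k \<noteq> 0" unfolding Z_def by (rule chart_nonzero[OF s(1)[OF \<mu>]])
    have double_less: "x * 2 < c" if "0 < x" "4 * x < c" for x c :: real using that by linarith
    have "exp (2 * Re (zt \<mu> k)) \<le> exp (1 / 2)"
      using complex_Re_le_cmod[of "zt \<mu> k"] zt(1)[OF \<mu>, of k] \<eta>4 by simp
    then have "exp (2 * Re (zt \<mu> k)) \<le> 2" using exp_half_le2 by linarith
    then have "(norm (Z \<mu> k))\<^sup>2 \<le> - \<mu> / l1 * 2"
      unfolding Z_def norm_chart_squared[OF s(1)[OF \<mu>]] using s(1)[OF \<mu>] by (intro mult_left_mono) auto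
    also have "\<dots> < \<rho>\<^sup>2" by (rule double_less[OF s(1,3)[OF \<mu>]])
    finally show "norm (Z \<mu> k) < \<rho>" using \<rho> by (intro power2_less_imp_less[of _ \<rho>]) auto
  qed
  have type: "nondegenerate_equilibrium (V \<mu>) (Z \<mu> k) \<and>
      (if (even k \<longleftrightarrow> \<alpha> * l1 > 0) then is_saddle (V \<mu>) (Z \<mu> k) else is_center (V \<mu>) (Z \<mu> k))"
    if \<mu>: "\<bar>\<mu>\<bar> < \<mu>0" "\<mu> * l1 < 0" for \<mu> k
  proof -
    define d where "d = rdet (frechet_derivative (V \<mu>) (at (Z \<mu> k)))"
    have "d = rdet (Dh (- \<mu> / l1) k (zt \<mu> k))"
      using rdet_V_at_zero[OF s(1)[OF \<mu>] zt(2)[OF \<mu>]] unfolding d_def Z_def s(4)[OF \<mu>] .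
    then have neg: "(\<alpha> * l1) * ((-1) ^ k * d) < 0"
      using zero[OF s(1,2)[OF \<mu>] zt[OF \<mu>]] by (simp add: mult_ac)
    \<comment> \<open>Stated for an arbitrary \<open>p\<close> in place of
      \<open>\<alpha> * l1\<close>, so that the case analysis on signs does not split this
      product.\<close>
    have sign: "d < 0 \<longleftrightarrow> (even k \<longleftrightarrow> p > 0)" if "p * ((-1) ^ k * d) < 0" for p
      using that by (cases "even k") (auto simp: mult_less_0_iff zero_less_mult_iff)
    have "d \<noteq> 0" using neg by auto
    then have "nondegenerate_equilibrium (V \<mu>) (Z \<mu> k)"
      using VZ(1)[OF \<mu>] V_differentiable by (simp add: nondegenerate_equilibrium_def det_jacobian d_def)
    moreover have "d < 0 \<longleftrightarrow> (even k \<longleftrightarrow> \<alpha> * l1 > 0)" by (rule sign[OF neg])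
    moreover have "is_saddle (V \<mu>) (Z \<mu> k)" if "d < 0"
      using that VZ(1)[OF \<mu>] V_differentiable div_free by (intro is_saddle_of_rdet_neg) (auto simp: d_def)
    moreover have "is_center (V \<mu>) (Z \<mu> k)" if "d > 0"
      using that VZ(1)[OF \<mu>] V_differentiable div_free by (intro is_center_of_rdet_pos) (auto simp: d_def)
    ultimately show ?thesis using \<open>d \<noteq> 0\<close> by (smt (verit))
  qed
  have all_zeros: "{z \<in> ball 0 \<rho>. V \<mu> z = 0} = insert 0 (Z \<mu> ` {..<4 * q})"
    if \<mu>: "\<bar>\<mu>\<bar> < \<mu>0" "\<mu> * l1 < 0" for \<mu>
  proof (intro equalityI subsetI)
    fix z assume "z \<in> {z \<in> ball 0 \<rho>. V \<mu> z = 0}"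
    then have z: "norm z < \<rho>" "V \<mu> z = 0" by auto
    show "z \<in> insert 0 (Z \<mu> ` {..<4 * q})"
    proof (cases "z = 0")
      case False
      then obtain k \<zeta> where k: "k < 4 * q" and \<zeta>: "norm \<zeta> \<le> \<eta>" and zc: "z = chart (- \<mu> / l1) k \<zeta>"
        using locate[of \<mu> z] z \<mu> by (auto simp: \<mu>0_def)
      have "h (- \<mu> / l1) k \<zeta> = 0"
        using V_chart_eq_0_iff[OF s(1)[OF \<mu>], of k \<zeta>] z(2) zc s(4)[OF \<mu>] by simp
      then have "z = Z \<mu> k" using zt_eq[OF \<mu> \<zeta>] zc by (simp add: Z_def)
      with k show ?thesis by blast
    qed simp
  qed (use VZ[OF \<mu>] V0[OF \<mu>(1)] \<rho> in auto)
  have inj: "inj_on (Z \<mu>) {..<4 * q}" if \<mu>: "\<bar>\<mu>\<bar> < \<mu>0" "\<mu> * l1 < 0" for \<mu>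
  proof (rule inj_onI)
    fix k j assume "k \<in> {..<4 * q}" "j \<in> {..<4 * q}" "Z \<mu> k = Z \<mu> j"
    then show "k = j"
      using zt(1)[OF \<mu>, of k] zt(1)[OF \<mu>, of j] \<eta>(2)
      by (intro chart_inj[OF s(1)[OF \<mu>], of "zt \<mu> k" "zt \<mu> j"]) (auto simp: Z_def)
  qed
  have near0: "\<forall>\<^sub>F \<mu> in at 0 within {\<mu>. \<mu> * l1 < 0}. \<bar>\<mu>\<bar> < \<mu>0 \<and> \<mu> * l1 < 0"
    unfolding eventually_at using \<mu>0 by (intro exI[of _ \<mu>0]) auto
  have norm_asymp: "(\<lambda>\<mu>. (norm (Z \<mu> k))\<^sup>2 - (- \<mu> / l1)) \<in> O[at 0 within {\<mu>. \<mu> * l1 < 0}](\<lambda>\<mu>. \<mu> ^ 2)" for k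
  \<comment> \<open>The constant: \<open>norm z ^ 2 - s = s * (exp x - 1)\<close> with
    \<open>\<bar>x\<bar> \<le> 2 * N * s\<close>, and
    \<open>\<bar>exp x - 1\<bar> \<le> 2 * \<bar>x\<bar>\<close>, where
    \<open>s = - \<mu> / l1\<close>.\<close>
  proof (rule bigoI[where c = "4 * N / l1\<^sup>2"])
    show "\<forall>\<^sub>F \<mu> in at 0 within {\<mu>. \<mu> * l1 < 0}.
        norm ((norm (Z \<mu> k))\<^sup>2 - (- \<mu> / l1)) \<le> 4 * N / l1\<^sup>2 * norm (\<mu>\<^sup>2)"
      using near0
    proof eventually_elim
      case (elim \<mu>)
      then have \<mu>: "\<bar>\<mu>\<bar> < \<mu>0" "\<mu> * l1 < 0" by auto
      define s where "s = - \<mu> / l1"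
      define x where "x = 2 * Re (zt \<mu> k)"
      have sp: "s > 0" using s(1)[OF \<mu>] by (simp add: s_def)
      have "norm (zt \<mu> k) \<le> N * s"
        using zero[OF s(1,2)[OF \<mu>] zt[OF \<mu>, of k]] by (simp add: s_def)
      then have "\<bar>x\<bar> \<le> 2 * (N * s)" "\<bar>x\<bar> \<le> 1 / 2"
        using abs_Re_le_cmod[of "zt \<mu> k"] zt(1)[OF \<mu>, of k] \<eta>4 by (auto simp: x_def)
      with abs_exp_minus_one_le[of x] have ex: "\<bar>exp x - 1\<bar> \<le> 4 * N * s" by simp
      have "(norm (Z \<mu> k))\<^sup>2 - (- \<mu> / l1) = s * (exp x - 1)"
        using norm_chart_squared[OF sp, of k "zt \<mu> k"] by (simp add: Z_def s_def x_def algebra_simps)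
      also have "norm \<dots> \<le> s * (4 * N * s)"
        using mult_left_mono[OF ex, of s] sp by (simp add: abs_mult)
      also have "\<dots> = 4 * N / l1\<^sup>2 * norm (\<mu>\<^sup>2)"
        by (simp add: s_def power2_eq_square)
      finally show ?case .
    qed
  qed
  have arg_asymp: "((\<lambda>\<mu>. Z \<mu> k / complex_of_real (norm (Z \<mu> k))) \<longlongrightarrow> cis (real k * pi / (2 * real q)))
          (at 0 within {\<mu>. \<mu> * l1 < 0})" for k
  proof -
    \<comment> \<open>The direction of \<open>Z \<mu> k\<close> deviates from the expected one by
      exactly the angle \<open>Im (zt \<mu> k)\<close>, which is \<open>O(\<mu>)\<close>.\<close>
    have "((\<lambda>\<mu>. Im (zt \<mu> k)) \<longlongrightarrow> 0) (at 0 within {\<mu>. \<mu> * l1 < 0})"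
    proof (rule Lim_null_comparison)
      show "\<forall>\<^sub>F \<mu> in at 0 within {\<mu>. \<mu> * l1 < 0}. norm (Im (zt \<mu> k)) \<le> N * (- \<mu> / l1)"
        using near0
      proof eventually_elim
        case (elim \<mu>)
        then have \<mu>: "\<bar>\<mu>\<bar> < \<mu>0" "\<mu> * l1 < 0" by auto
        show ?case
          using zero[OF s(1,2)[OF \<mu>] zt[OF \<mu>, of k]] abs_Im_le_cmod[of "zt \<mu> k"] by simp
      qed
      have "((\<lambda>\<mu>. N * (- \<mu> / l1)) \<longlongrightarrow> N * (- 0 / l1)) (at 0 within {\<mu>. \<mu> * l1 < 0})"
        using l1 by (intro tendsto_intros)
      then show "((\<lambda>\<mu>. N * (- \<mu> / l1)) \<longlongrightarrow> 0) (at 0 within {\<mu>. \<mu> * l1 < 0})" by simp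
    qed
    then have "((\<lambda>\<mu>. cis (Im (zt \<mu> k) + real k * pi / (2 * real q))) \<longlongrightarrow> cis (0 + real k * pi / (2 * real q)))
        (at 0 within {\<mu>. \<mu> * l1 < 0})"
      unfolding cis_conv_exp by (intro tendsto_intros)
    moreover have "\<forall>\<^sub>F \<mu> in at 0 within {\<mu>. \<mu> * l1 < 0}.
        cis (Im (zt \<mu> k) + real k * pi / (2 * real q)) = Z \<mu> k / complex_of_real (norm (Z \<mu> k))"
      using near0
    proof eventually_elim
      case (elim \<mu>)
      then show ?case using chart_direction[OF s(1)] by (simp add: Z_def)
    qed
    ultimately show ?thesis by (auto intro: Lim_transform_eventually)
  qed
  show ?thesis
  proof (intro exI[of _ "ball 0 \<rho>"] exI[of _ \<mu>0] exI[of _ Z] conjI allI impI)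
    fix \<mu> assume *: "\<mu> \<noteq> 0 \<and> \<bar>\<mu>\<bar> < \<mu>0 \<and> \<mu> * l1 > 0"
    show "{z \<in> ball 0 \<rho>. V \<mu> z = 0} = {0}"
      using locate[of \<mu>] V0[of \<mu>] * \<rho> by (force simp: \<mu>0_def)
    show "is_center (V \<mu>) 0" using center0 * by blast
  next
    fix \<mu> assume *: "\<mu> \<noteq> 0 \<and> \<bar>\<mu>\<bar> < \<mu>0 \<and> \<mu> * l1 < 0"
    show "is_center (V \<mu>) 0" using center0 * by blast
    show "{z \<in> ball 0 \<rho>. V \<mu> z = 0} = insert 0 (Z \<mu> ` {..<4 * q})" using all_zeros * by blast
    show "inj_on (Z \<mu>) {..<4 * q}" using inj * by blast
    show "0 \<notin> Z \<mu> ` {..<4 * q}" using VZ(2) * by force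
    show "nondegenerate_equilibrium (V \<mu>) (Z \<mu> k)" for k using type * by blast
    show "if (even k \<longleftrightarrow> \<alpha> * l1 > 0) then is_saddle (V \<mu>) (Z \<mu> k) else is_center (V \<mu>) (Z \<mu> k)" for k
      using type * by blast
  qed (use \<rho> \<mu>0 norm_asymp arg_asymp in auto)
qed

end

section \<open>Reduction of the smoothness hypotheses to explicit bounds\<close>

theorem theorem1:
  fixes q :: nat and l1 \<alpha> :: real and \<Phi> :: "real \<Rightarrow> real"
    and R :: "real \<times> complex \<Rightarrow> complex" and V :: "real \<Rightarrow> complex \<Rightarrow> complex"
  assumes q: "odd q" "q \<ge> 3"
    and l1: "l1 \<noteq> 0" and \<alpha>: "\<alpha> \<noteq> 0"
    and \<Phi>_smooth: "smooth_on UNIV \<Phi>"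
    and \<Phi>_exp: "(\<lambda>s. \<Phi> s - l1 * s) \<in> O[at 0](\<lambda>s. s ^ 2)"
    and R_smooth: "smooth_on UNIV R"
    and R_small: "\<exists>C \<delta>. \<delta> > 0 \<and> (\<forall>\<mu> z. \<bar>\<mu>\<bar> < \<delta> \<and> norm z < \<delta> \<longrightarrow>
                      norm (R (\<mu>, z)) \<le> C * norm z ^ (2 * q + 1))"
    and V_def: "\<And>\<mu> z. V \<mu> z = \<i> * complex_of_real \<mu> * z
                   + \<i> * complex_of_real (\<Phi> ((norm z)\<^sup>2)) * z
                   + \<i> * complex_of_real \<alpha> * (cnj z) ^ (2 * q - 1) + R (\<mu>, z)"
    and div_free: "\<And>\<mu> z. divergence (V \<mu>) z = 0"
  shows "\<exists>U \<mu>0 (Z :: real \<Rightarrow> nat \<Rightarrow> complex). open U \<and> 0 \<in> U \<and> \<mu>0 > 0 \<and>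
     (\<forall>\<mu>. \<mu> \<noteq> 0 \<and> \<bar>\<mu>\<bar> < \<mu>0 \<and> \<mu> * l1 > 0 \<longrightarrow>
          {z \<in> U. V \<mu> z = 0} = {0} \<and> is_center (V \<mu>) 0) \<and>
     (\<forall>\<mu>. \<mu> \<noteq> 0 \<and> \<bar>\<mu>\<bar> < \<mu>0 \<and> \<mu> * l1 < 0 \<longrightarrow>
          is_center (V \<mu>) 0 \<and>
          {z \<in> U. V \<mu> z = 0} = insert 0 (Z \<mu> ` {..<4 * q}) \<and>
          inj_on (Z \<mu>) {..<4 * q} \<and> 0 \<notin> Z \<mu> ` {..<4 * q} \<and>
          (\<forall>k < 4 * q. nondegenerate_equilibrium (V \<mu>) (Z \<mu> k) \<and>
             (if (even k \<longleftrightarrow> \<alpha> * l1 > 0) then is_saddle (V \<mu>) (Z \<mu> k)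
              else is_center (V \<mu>) (Z \<mu> k)))) \<and>
     (\<forall>k < 4 * q.
        (\<lambda>\<mu>. (norm (Z \<mu> k))\<^sup>2 - (- \<mu> / l1)) \<in> O[at 0 within {\<mu>. \<mu> * l1 < 0}](\<lambda>\<mu>. \<mu> ^ 2) \<and>
        ((\<lambda>\<mu>. Z \<mu> k / complex_of_real (norm (Z \<mu> k))) \<longlongrightarrow> cis (real k * pi / (2 * real q)))
          (at 0 within {\<mu>. \<mu> * l1 < 0}))"
proof -
  obtain D where D: "D 0 = \<Phi>" "\<And>m x. D m differentiable at x"
    "\<And>m x. D (Suc m) x = frechet_derivative (D m) (at x) 1"
    by (rule smooth_on_iterated_directional[OF \<Phi>_smooth, of 1]) simp
  define \<Phi>' where "\<Phi>' = D 1"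
  have \<Phi>_deriv: "(\<Phi> has_real_derivative \<Phi>' s) (at s)" for s
  proof -
    have d: "\<Phi> differentiable at s" using D(1) D(2)[of 0 s] by simp
    then obtain c where c: "(\<Phi> has_real_derivative c) (at s)"
      by (auto simp: real_differentiable_def)
    then have "frechet_derivative \<Phi> (at s) = (*) c"
      using frechet_derivative_at unfolding has_field_derivative_def by metis
    then have "\<Phi>' s = c" using D(1,3) by (simp add: \<Phi>'_def)
    with c show ?thesis by simp
  qed
  have \<Phi>'_cont: "isCont \<Phi>' 0"
    unfolding \<Phi>'_def using D(2) differentiable_imp_continuous_within by blast
  obtain K0 where "\<forall>\<^sub>F s in at 0. norm (\<Phi> s - l1 * s) \<le> K0 * norm (s\<^sup>2)"
    using \<Phi>_exp by (elim landau_o.bigE)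
  then obtain d0 where d0: "d0 > 0" and K0: "\<And>s. s \<noteq> 0 \<Longrightarrow> \<bar>s\<bar> < d0 \<Longrightarrow> \<bar>\<Phi> s - l1 * s\<bar> \<le> K0 * s\<^sup>2"
    by (auto simp: eventually_at dist_norm)
  define K where "K = \<bar>K0\<bar>"
  have K_ne: "\<bar>\<Phi> s - l1 * s\<bar> \<le> K * s\<^sup>2" if "s \<noteq> 0" "\<bar>s\<bar> < d0" for s
  proof -
    have "K0 * s\<^sup>2 \<le> K * s\<^sup>2" by (intro mult_right_mono) (auto simp: K_def)
    with K0[OF that] show ?thesis by linarith
  qed
  \<comment> \<open>The filter \<open>at 0\<close> is punctured, so the value at 0 has to be
    recovered by continuity.\<close>
  have \<Phi>_0: "\<Phi> 0 = 0"
  proof -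
    have "(\<Phi> \<longlongrightarrow> \<Phi> 0) (at 0)" using DERIV_isCont[OF \<Phi>_deriv] by (simp add: isCont_def)
    then have "((\<lambda>s. \<Phi> s - l1 * s) \<longlongrightarrow> \<Phi> 0 - l1 * 0) (at 0)" by (intro tendsto_intros)
    moreover have "((\<lambda>s. \<Phi> s - l1 * s) \<longlongrightarrow> 0) (at 0)"
    proof (rule Lim_null_comparison)
      show "\<forall>\<^sub>F s in at 0. norm (\<Phi> s - l1 * s) \<le> K * s\<^sup>2"
        unfolding eventually_at using d0 K_ne by (intro exI[of _ d0]) auto
      have "((\<lambda>s. K * s\<^sup>2) \<longlongrightarrow> K * 0\<^sup>2) (at (0::real))" by (intro tendsto_intros)
      then show "((\<lambda>s. K * s\<^sup>2) \<longlongrightarrow> 0) (at (0::real))" by simp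
    qed
    ultimately show ?thesis using LIM_unique by fastforce
  qed
  have K: "\<bar>\<Phi> s - l1 * s\<bar> \<le> K * s\<^sup>2" if "\<bar>s\<bar> < d0" for s
    using K_ne[of s] that \<Phi>_0 by (cases "s = 0") auto
  have "((\<lambda>s. \<Phi> s - l1 * s) has_derivative (\<lambda>_. 0)) (at 0)"
    using K by (intro has_derivative_zero_of_quadratic[OF d0, of _ K]) auto
  then have "((\<lambda>s. \<Phi> s - l1 * s) has_real_derivative 0) (at 0)"
    by (simp add: has_field_derivative_def flip: lambda_zero)
  moreover have "((\<lambda>s. \<Phi> s - l1 * s) has_real_derivative \<Phi>' 0 - l1) (at 0)"
    by (auto intro!: derivative_eq_intros \<Phi>_deriv)
  ultimately have \<Phi>'_0: "\<Phi>' 0 = l1" using DERIV_unique by fastforce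
  obtain C0 \<delta>0 where \<delta>0: "\<delta>0 > 0" and C0: "\<And>\<mu> z. \<bar>\<mu>\<bar> < \<delta>0 \<Longrightarrow> norm z < \<delta>0 \<Longrightarrow>
      norm (R (\<mu>, z)) \<le> C0 * norm z ^ (2 * q + 1)"
    using R_small by blast
  obtain C1 where C1: "C1 \<ge> 0" and DR: "\<And>\<mu> z w. \<bar>\<mu>\<bar> < \<delta>0 / 2 \<Longrightarrow> norm z < \<delta>0 / 2 \<Longrightarrow> z \<noteq> 0 \<Longrightarrow>
      norm (frechet_derivative R (at (\<mu>, z)) (0, w)) \<le> C1 * norm z ^ (2 * q) * norm w"
    using partial_derivative_small[OF R_smooth, of "2 * q" \<delta>0 C0] \<delta>0 C0 q by auto
  define C where "C = \<bar>C0\<bar> + C1"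
  \<comment> \<open>Half of \<open>\<delta>0\<close> because the derivative of \<open>R\<close> is
    controlled on the half-size region only; \<open>d0\<close> is the range of the bound on
    \<Phi>.\<close>
  define \<delta> where "\<delta> = min 1 (min d0 (\<delta>0 / 2))"
  have R_deriv: "((\<lambda>z. R (\<mu>, z)) has_derivative (\<lambda>w. frechet_derivative R (at (\<mu>, z)) (0, w))) (at z)" for \<mu> z
  proof -
    have "R differentiable at (\<mu>, z)"
      using R_smooth unfolding smooth_on_def differentiable_on_def by blast
    then have "(R has_derivative frechet_derivative R (at (\<mu>, z))) (at (\<mu>, z))"
      by (simp add: frechet_derivative_works)
    moreover have "((\<lambda>z. (\<mu>, z)) has_derivative (\<lambda>w. (0, w))) (at z)"
      by (auto intro!: derivative_eq_intros)
    ultimately show ?thesis using has_derivative_compose by blast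
  qed
  interpret G: garland_flow q l1 \<alpha> \<Phi> \<Phi>' "\<lambda>\<mu> z. R (\<mu>, z)"
    "\<lambda>\<mu> z w. frechet_derivative R (at (\<mu>, z)) (0, w)" K C \<delta>
  proof
    show "norm (R (\<mu>, z)) \<le> C * norm z ^ (2 * q + 1)" if "\<bar>\<mu>\<bar> < \<delta>" "norm z < \<delta>" for \<mu> z
    proof -
      have "norm (R (\<mu>, z)) \<le> C0 * norm z ^ (2 * q + 1)" using that \<delta>0 by (intro C0) (auto simp: \<delta>_def)
      also have "\<dots> \<le> C * norm z ^ (2 * q + 1)" using C1 by (intro mult_right_mono) (auto simp: C_def)
      finally show ?thesis .
    qed
    show "norm (frechet_derivative R (at (\<mu>, z)) (0, w)) \<le> C * norm z ^ (2 * q) * norm w"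
      if "\<bar>\<mu>\<bar> < \<delta>" "norm z < \<delta>" "z \<noteq> 0" for \<mu> z w
    proof -
      have "norm (frechet_derivative R (at (\<mu>, z)) (0, w)) \<le> C1 * norm z ^ (2 * q) * norm w"
        using that by (intro DR) (auto simp: \<delta>_def)
      also have "\<dots> \<le> C * norm z ^ (2 * q) * norm w" by (intro mult_right_mono) (auto simp: C_def)
      finally show ?thesis .
    qed
  qed (use q l1 \<alpha> \<Phi>_deriv \<Phi>'_0 \<Phi>'_cont d0 \<delta>0 C1 K R_deriv in \<open>auto simp: \<delta>_def K_def C_def\<close>)
  have VG: "V = G.V" by (intro ext) (simp only: V_def G.V_def)
  show ?thesis unfolding VG by (rule G.garland[OF div_free[unfolded VG]])
qed

end
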